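(* Let $p$ be a prime, let $g$ be a primitive root modulo $p$, and let $N<p^{1/2}$ be a positive integer. Then $$\frac{1}{p}\sum_{x=0}^{p-1}\left|\sum_{n\le N}e^{2\pi i\frac{x}{p}g^n}\right|\gg N^{1/48+o(1)},$$ where $o(1)$ denotes a quantity tending to $0$ as $N\to\infty$. *)

theory Defs
  imports "HOL-Analysis.Analysis" "HOL-Number_Theory.Number_Theory"
begin

definition e_char :: "real \<Rightarrow> complex" where
  "e_char t = exp (2 * of_real pi * \<i> * of_real t)"

end

theory Submission
  imports Defs
begin

text \<open>
  By Hoelder's inequality the mean of the absolute values of the exponential sums is at least
  \<open>sqrt (N ^ 3 / E)\<close>, where \<open>E\<close> is the additive energy of \<open>{g, \<dots>, g ^ N}\<close>, and \<open>E\<close> is at most about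
  \<open>N\<^sup>2 M\<close>, where \<open>M\<close> is the largest number of solutions of \<open>g ^ i - g ^ k \<equiv> D\<close> with \<open>i, k \<le> N\<close> and
  \<open>D\<close> nonzero. It remains to show \<open>M ^ 23 = O(N ^ 22)\<close>.

  Write \<open>\<gamma> n\<close> for \<open>g ^ n\<close>. Translating exponents, every solution turns into the relations
  \<open>\<gamma> a - \<gamma> (a - \<delta>) \<equiv> D \<gamma> (a - i)\<close> with \<open>\<delta> = i - k\<close>. If \<open>a - f\<close> has many representations
  \<open>\<delta> - \<delta>'\<close>, then \<open>\<gamma> a - \<gamma> f\<close> has many representations \<open>D (\<gamma> s - \<gamma> t)\<close>, and this holds for almost all
  pairs of exponents from \<open>\<Delta>\<close>. Let \<open>B\<close> be the set of the \<open>b \<in> \<Delta>\<close> that form such a pair with almost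
  every \<open>f \<in> \<Delta>\<close>.

  Unless \<open>M\<close> is small, the ratios \<open>(\<gamma> x - \<gamma> x') / (\<gamma> y - \<gamma> y')\<close> with arguments in \<open>B\<close> are too few to
  exhaust the field, so there is a ratio \<open>u / v\<close> such that \<open>u / v - 1\<close> is not a ratio. Hence the values \<open>v \<gamma> x + (u - v) \<gamma> y\<close> with \<open>x, y \<in> B\<close> are pairwise distinct. On the other
  hand, replacing the exponents that occur in \<open>v\<close> and \<open>u - v\<close> by partners in \<open>\<Delta>\<close> and applying the
  Cauchy-Schwarz inequality shows that on average each value has many representations as a signed
  sum of twelve terms \<open>D \<gamma> t\<close> with \<open>t = O(N)\<close>. Comparison with the number of such sums bounds \<open>M\<close>.
\<close>

section \<open>Differences in a geometric progression\<close>

lemma card_Sigma_ge: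
  fixes R :: real
  assumes "finite A" "\<And>a. a \<in> A \<Longrightarrow> finite (F a)" "\<And>a. a \<in> A \<Longrightarrow> R \<le> real (card (F a))"
  shows "real (card A) * R \<le> real (card (Sigma A F))"
proof -
  have "real (card A) * R \<le> (\<Sum>a\<in>A. real (card (F a)))"
    using sum_bounded_below[of A R "\<lambda>a. real (card (F a))"] assms(3) by simp
  then show ?thesis
    using assms by simp
qed

definition collisions :: "'a set \<Rightarrow> ('a \<Rightarrow> 'b) \<Rightarrow> ('a \<times> 'a) set" where
  "collisions H k = {(a, b) \<in> H \<times> H. k a = k b}"

lemma finite_collisions: "finite H \<Longrightarrow> finite (collisions H k)"
  unfolding collisions_def by (rule finite_subset[of _ "H \<times> H"]) auto

text \<open>Cauchy-Schwarz on the fibre sizes: they sum to \<open>card H\<close>, and their squares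
  sum to the number of collisions.\<close>

lemma card_collisions_ge:
  assumes H: "finite H" and K: "finite K" and k: "k ` H \<subseteq> K"
  shows "(real (card H))\<^sup>2 \<le> real (card K) * real (card (collisions H k))"
proof -
  define F where "F c = {a \<in> H. k a = c}" for c
  have fin: "finite (F c)" for c using H by (simp add: F_def)
  have "H = (\<Union>c\<in>K. F c)" using k by (auto simp: F_def)
  then have "card H = card (\<Union>c\<in>K. F c)" by simp
  also have "\<dots> = (\<Sum>c\<in>K. card (F c))"
    by (rule card_UN_disjoint) (use K fin in \<open>auto simp: F_def\<close>)
  finally have 1: "card H = (\<Sum>c\<in>K. card (F c))" .
  have "collisions H k = (\<Union>c\<in>K. F c \<times> F c)"
    using k by (auto simp: F_def collisions_def)
  then have "card (collisions H k) = card (\<Union>c\<in>K. F c \<times> F c)" by simp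
  also have "\<dots> = (\<Sum>c\<in>K. card (F c \<times> F c))"
    by (rule card_UN_disjoint) (use K fin in \<open>auto simp: F_def\<close>)
  finally have 2: "real (card (collisions H k)) = (\<Sum>c\<in>K. (real (card (F c)))\<^sup>2)"
    by (simp add: card_cartesian_product power2_eq_square)
  have "(\<Sum>c\<in>K. 1 * real (card (F c)))\<^sup>2 \<le> (\<Sum>c\<in>K. 1\<^sup>2) * (\<Sum>c\<in>K. (real (card (F c)))\<^sup>2)"
    by (rule Cauchy_Schwarz_ineq_sum)
  then show ?thesis
    by (simp add: 1 2)
qed

text \<open>
  \<open>\<gamma>\<close> is the exponential \<open>n \<mapsto> g ^ n\<close> modulo \<open>p\<close>. The solutions of \<open>g ^ i - g ^ k \<equiv> D\<close> are encoded
  by the set \<open>\<Delta>\<close> of the differences \<open>i - k\<close>, with \<open>\<phi> (i - k) = i\<close>.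
\<close>

locale zech_set =
  fixes p N D :: int and \<gamma> :: "int \<Rightarrow> int" and \<Delta> :: "int set" and \<phi> :: "int \<Rightarrow> int"
  assumes prime_p: "prime p"
    and N_ge: "5 \<le> N"
    and N_less: "N\<^sup>2 < p"
    and \<gamma>_add: "[\<gamma> (a + b) = \<gamma> a * \<gamma> b] (mod p)"
    and \<gamma>_nz: "\<not> p dvd \<gamma> a"
    and \<gamma>_inj: "[\<gamma> a = \<gamma> b] (mod p) \<Longrightarrow> \<bar>a - b\<bar> \<le> 3 * N \<Longrightarrow> a = b"
    and D_nz: "\<not> p dvd D"
    and \<Delta>_range: "\<Delta> \<subseteq> {-N..N}"
    and \<phi>_range: "\<phi> ` \<Delta> \<subseteq> {1..N}"
    and \<phi>_inj: "inj_on \<phi> \<Delta>"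
    and edge0: "\<delta> \<in> \<Delta> \<Longrightarrow> [\<gamma> \<delta> - 1 = D * \<gamma> (\<delta> - \<phi> \<delta>)] (mod p)"
begin

section \<open>Relations between powers and representations of their differences\<close>

abbreviation cg :: "int \<Rightarrow> int \<Rightarrow> bool" (infix "\<simeq>" 50) where
  "a \<simeq> b \<equiv> [a = b] (mod p)"

definition M :: real where "M = real (card \<Delta>)"
definition n :: real where "n = of_int N"

lemma n_ge: "5 \<le> n" using N_ge by (simp add: n_def)

lemma finite_\<Delta>: "finite \<Delta>" using \<Delta>_range finite_subset by blast

lemma M_le_n: "M \<le> n"
proof -
  have "card \<Delta> = card (\<phi> ` \<Delta>)" using \<phi>_inj by (simp add: card_image)
  also have "\<dots> \<le> card {1..N}" using \<phi>_range by (intro card_mono) auto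
  also have "\<dots> = nat N" by simp
  finally show ?thesis using N_ge unfolding M_def n_def by linarith
qed

lemma M_nonneg: "0 \<le> M" by (simp add: M_def)

lemma cancel:
  assumes "\<not> p dvd c" "c * a \<simeq> c * b"
  shows "a \<simeq> b"
proof -
  have "coprime c p"
    using prime_imp_coprime[OF prime_p assms(1)] by (rule coprime_commute[THEN iffD1])
  from cong_mult_lcancel[OF this, of a b] assms(2) show ?thesis by (rule iffD1)
qed

text \<open>Multiplying \<open>edge0\<close> by \<open>\<gamma> (a - \<delta>)\<close> moves the
  relation to an arbitrary exponent \<open>a\<close>. Read as a graph, \<open>a\<close> is joined to
  \<open>a - \<delta>\<close> by an edge with label \<open>a - \<phi> \<delta>\<close>.\<close>

lemma edge:
  assumes "\<delta> \<in> \<Delta>"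
  shows "\<gamma> a - \<gamma> (a - \<delta>) \<simeq> D * \<gamma> (a - \<phi> \<delta>)"
proof -
  have 1: "\<gamma> a \<simeq> \<gamma> (a - \<delta>) * \<gamma> \<delta>" using \<gamma>_add[of "a - \<delta>" \<delta>] by simp
  have "\<gamma> (a - \<delta>) * (\<gamma> \<delta> - 1) \<simeq> \<gamma> (a - \<delta>) * (D * \<gamma> (\<delta> - \<phi> \<delta>))"
    by (rule cong_mult[OF cong_refl edge0[OF assms]])
  then have 2: "\<gamma> (a - \<delta>) * \<gamma> \<delta> - \<gamma> (a - \<delta>) \<simeq> D * (\<gamma> (a - \<delta>) * \<gamma> (\<delta> - \<phi> \<delta>))"
    by (simp add: algebra_simps)
  have "D * \<gamma> (a - \<phi> \<delta>) \<simeq> D * (\<gamma> (a - \<delta>) * \<gamma> (\<delta> - \<phi> \<delta>))"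
    using \<gamma>_add[of "a - \<delta>" "\<delta> - \<phi> \<delta>"] by (intro cong_mult) auto
  with 2 have "\<gamma> (a - \<delta>) * \<gamma> \<delta> - \<gamma> (a - \<delta>) \<simeq> D * \<gamma> (a - \<phi> \<delta>)"
    using cong_sym cong_trans by blast
  moreover have "\<gamma> a - \<gamma> (a - \<delta>) \<simeq> \<gamma> (a - \<delta>) * \<gamma> \<delta> - \<gamma> (a - \<delta>)"
    by (intro cong_diff 1 cong_refl)
  ultimately show ?thesis using cong_trans by blast
qed

text \<open>The exponents \<open>a\<close> and \<open>f\<close> have the common neighbour
  \<open>a - \<delta> = f - \<delta>'\<close>; subtracting the two instances of \<open>edge\<close>
  eliminates it. Only the two labels are stored, since these are the exponents that remain in the
  resulting relation \<open>S_cong\<close>.\<close>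

definition S :: "int \<Rightarrow> int \<Rightarrow> (int \<times> int) set" where
  "S a f = (\<lambda>(\<delta>, \<delta>'). (a - \<phi> \<delta>, f - \<phi> \<delta>')) ` {(\<delta>, \<delta>') \<in> \<Delta> \<times> \<Delta>. \<delta> - \<delta>' = a - f}"

lemma finite_S: "finite (S a f)"
  unfolding S_def by (rule finite_imageI, rule finite_subset[of _ "\<Delta> \<times> \<Delta>"]) (auto simp: finite_\<Delta>)

lemma card_S: "card (S a f) = card {(\<delta>, \<delta>') \<in> \<Delta> \<times> \<Delta>. \<delta> - \<delta>' = a - f}"
proof -
  have "inj_on (\<lambda>(\<delta>, \<delta>'). (a - \<phi> \<delta>, f - \<phi> \<delta>')) (\<Delta> \<times> \<Delta>)"
    using \<phi>_inj by (auto simp: inj_on_def)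
  then show ?thesis
    unfolding S_def by (intro card_image) (rule inj_on_subset, auto)
qed

lemma S_cong: "(s, t) \<in> S a f \<Longrightarrow> \<gamma> a - \<gamma> f \<simeq> D * (\<gamma> s - \<gamma> t)"
proof -
  assume "(s, t) \<in> S a f"
  then obtain d d' where d: "d \<in> \<Delta>" "d' \<in> \<Delta>" "d - d' = a - f" "s = a - \<phi> d" "t = f - \<phi> d'"
    by (auto simp: S_def)
  have eq: "f - d' = a - d" using d by simp
  have "(\<gamma> a - \<gamma> (a - d)) - (\<gamma> f - \<gamma> (a - d)) \<simeq> D * \<gamma> s - D * \<gamma> t"
    using cong_diff[OF edge[OF d(1), of a] edge[OF d(2), of f, unfolded eq]] d(4,5) by simp
  then show ?thesis by (simp add: algebra_simps)
qed

lemma S_shift: "(s, t) \<in> S a f \<Longrightarrow> (\<gamma> a - \<gamma> f) * \<gamma> x \<simeq> D * (\<gamma> (x + s) - \<gamma> (x + t))"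
proof -
  assume "(s, t) \<in> S a f"
  then have "(\<gamma> a - \<gamma> f) * \<gamma> x \<simeq> D * (\<gamma> s - \<gamma> t) * \<gamma> x"
    by (intro cong_mult S_cong cong_refl)
  also have "D * (\<gamma> s - \<gamma> t) * \<gamma> x = D * (\<gamma> x * \<gamma> s - \<gamma> x * \<gamma> t)" by (simp add: algebra_simps)
  also have "D * (\<gamma> x * \<gamma> s - \<gamma> x * \<gamma> t) \<simeq> D * (\<gamma> (x + s) - \<gamma> (x + t))"
    by (intro cong_mult cong_diff cong_refl cong_sym[OF \<gamma>_add])
  finally show ?thesis .
qed

lemma S_E:
  assumes "(s, t) \<in> S a f"
  obtains d d' where "d \<in> \<Delta>" "d' \<in> \<Delta>" "d - d' = a - f" "s = a - \<phi> d" "t = f - \<phi> d'"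
  using assms by (auto simp: S_def)

lemma S_left_unique:
  assumes "(s, t) \<in> S a f" "(s', t) \<in> S a f"
  shows "s = s'"
proof -
  obtain d d' where 1: "d \<in> \<Delta>" "d' \<in> \<Delta>" "d - d' = a - f" "s = a - \<phi> d" "t = f - \<phi> d'"
    using S_E[OF assms(1)] .
  obtain c c' where 2: "c \<in> \<Delta>" "c' \<in> \<Delta>" "c - c' = a - f" "s' = a - \<phi> c" "t = f - \<phi> c'"
    using S_E[OF assms(2)] .
  have "d' = c'" using 1(2,5) 2(2,5) by (auto intro: inj_onD[OF \<phi>_inj])
  then have "d = c" using 1(3) 2(3) by simp
  then show ?thesis using 1(4) 2(4) by simp
qed

text \<open>The labels determine \<open>\<gamma> f\<close> modulo \<open>p\<close>, and two
  exponents in \<open>\<Delta>\<close> differ by at most \<open>2 * N\<close>, within the reach of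
  \<open>\<gamma>_inj\<close>. Auxiliary exponents can thus be recovered from labels, which makes
  the counting maps below injective.\<close>

lemma S_vertex_unique:
  assumes "(s, t) \<in> S a f" "(s, t) \<in> S a f'" "f \<in> \<Delta>" "f' \<in> \<Delta>"
  shows "f = f'"
proof -
  have "\<gamma> a - \<gamma> f \<simeq> \<gamma> a - \<gamma> f'"
    using S_cong[OF assms(1)] S_cong[OF assms(2)] cong_sym cong_trans by blast
  then have "\<gamma> a - (\<gamma> a - \<gamma> f) \<simeq> \<gamma> a - (\<gamma> a - \<gamma> f')" by (rule cong_diff[OF cong_refl])
  then have "\<gamma> f \<simeq> \<gamma> f'" by simp
  moreover have "f \<in> {-N..N}" "f' \<in> {-N..N}" using assms \<Delta>_range by auto
  ultimately show ?thesis using N_ge by (intro \<gamma>_inj) auto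
qed

lemma S_range:
  assumes "a \<in> \<Delta>" "f \<in> \<Delta>" "(s, t) \<in> S a f"
  shows "s \<in> {-2*N..N}" "t \<in> {-2*N..N}"
proof -
  obtain d d' where 1: "d \<in> \<Delta>" "d' \<in> \<Delta>" "s = a - \<phi> d" "t = f - \<phi> d'"
    using S_E[OF assms(3)] .
  have "\<phi> d \<in> {1..N}" "\<phi> d' \<in> {1..N}" "a \<in> {-N..N}" "f \<in> {-N..N}"
    using 1 assms \<Delta>_range \<phi>_range by auto
  then show "s \<in> {-2*N..N}" "t \<in> {-2*N..N}" using 1 by auto
qed

section \<open>Pairs of exponents with many representations\<close>

definition \<theta> :: real where "\<theta> = M\<^sup>2 / (80 * n)"

lemma \<theta>_nonneg: "0 \<le> \<theta>" using n_ge by (simp add: \<theta>_def)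

definition good :: "int \<Rightarrow> int \<Rightarrow> bool" where
  "good a f \<longleftrightarrow> \<theta> \<le> real (card (S a f))"

text \<open>A bad pair is itself a representation of an unpopular difference. There are at most
  \<open>5 * n\<close> differences, each unpopular one has fewer than \<open>\<theta>\<close>
  representations, and \<open>\<theta>\<close> is chosen so that
  \<open>5 * n * \<theta> = M\<^sup>2 / 16\<close>.\<close>

lemma card_bad_pairs: "real (card {(a, f) \<in> \<Delta> \<times> \<Delta>. \<not> good a f}) \<le> M\<^sup>2 / 16"
proof -
  define rep where "rep \<tau> = {(\<delta>, \<delta>') \<in> \<Delta> \<times> \<Delta>. \<delta> - \<delta>' = \<tau>}" for \<tau>
  have fin: "finite (rep \<tau>)" for \<tau>
    unfolding rep_def by (rule finite_subset[of _ "\<Delta> \<times> \<Delta>"]) (auto simp: finite_\<Delta>)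
  define T where "T = {\<tau> \<in> {-2*N..2*N}. real (card (rep \<tau>)) < \<theta>}"
  have finT: "finite T" unfolding T_def by (rule finite_subset[of _ "{-2*N..2*N}"]) auto
  have "{(a, f) \<in> \<Delta> \<times> \<Delta>. \<not> good a f} \<subseteq> (\<Union>\<tau>\<in>T. rep \<tau>)"
  proof clarify
    fix a f assume *: "a \<in> \<Delta>" "f \<in> \<Delta>" "\<not> good a f"
    have "a \<in> {-N..N}" "f \<in> {-N..N}" using * \<Delta>_range by auto
    then have "a - f \<in> T"
      using * by (auto simp: T_def good_def card_S rep_def)
    then show "(a, f) \<in> (\<Union>\<tau>\<in>T. rep \<tau>)" using * by (auto simp: rep_def)
  qed
  then have "card {(a, f) \<in> \<Delta> \<times> \<Delta>. \<not> good a f} \<le> card (\<Union>\<tau>\<in>T. rep \<tau>)"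
    using fin finT by (intro card_mono) auto
  also have "\<dots> \<le> (\<Sum>\<tau>\<in>T. card (rep \<tau>))" by (rule card_UN_le[OF finT])
  finally have "real (card {(a, f) \<in> \<Delta> \<times> \<Delta>. \<not> good a f}) \<le> (\<Sum>\<tau>\<in>T. real (card (rep \<tau>)))"
    by (simp only: of_nat_sum[symmetric] of_nat_le_iff)
  also have "\<dots> \<le> real (card T) * \<theta>"
    by (rule sum_bounded_above) (auto simp: T_def)
  also have "\<dots> \<le> 5 * n * \<theta>"
  proof (rule mult_right_mono[OF _ \<theta>_nonneg])
    have "card T \<le> card {-2*N..2*N}" by (intro card_mono) (auto simp: T_def)
    also have "\<dots> = nat (4 * N + 1)" by simp
    finally show "real (card T) \<le> 5 * n" using N_ge unfolding n_def by linarith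
  qed
  also have "\<dots> = M\<^sup>2 / 16" using n_ge by (simp add: \<theta>_def)
  finally show ?thesis .
qed

text \<open>The threshold \<open>M / 8\<close> leaves any four members of \<open>B\<close> with at
  least \<open>M / 2\<close> common good partners (\<open>card_common_good\<close>), while
  \<open>card_bad_pairs\<close> still keeps at least half of \<open>\<Delta>\<close> inside
  \<open>B\<close>.\<close>

definition B :: "int set" where
  "B = {b \<in> \<Delta>. real (card {f \<in> \<Delta>. \<not> good b f}) \<le> M / 8}"

lemma B_subset: "B \<subseteq> \<Delta>" by (auto simp: B_def)

lemma finite_B: "finite B" using B_subset finite_\<Delta> finite_subset by blast

lemma card_B: "M / 2 \<le> real (card B)"
proof (cases "M = 0")
  case False
  then have M: "M > 0" using M_nonneg by simp
  \<comment> \<open>Each exponent outside \<open>B\<close> accounts for more than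
    \<open>M / 8\<close> of the at most \<open>M\<^sup>2 / 16\<close> bad pairs.\<close>
  have "real (card (\<Delta> - B)) * (M / 8) \<le> real (card (SIGMA b : \<Delta> - B. {f \<in> \<Delta>. \<not> good b f}))"
    by (rule card_Sigma_ge) (auto simp: finite_\<Delta> B_def)
  also have "\<dots> \<le> real (card {(a, f) \<in> \<Delta> \<times> \<Delta>. \<not> good a f})"
  proof (intro of_nat_mono card_mono)
    show "finite {(a, f) \<in> \<Delta> \<times> \<Delta>. \<not> good a f}"
      by (rule finite_subset[of _ "\<Delta> \<times> \<Delta>"]) (auto simp: finite_\<Delta>)
  qed auto
  also note card_bad_pairs
  finally have "real (card (\<Delta> - B)) \<le> M / 2" using M by (simp add: power2_eq_square field_simps)
  moreover have "card (\<Delta> - B) = card \<Delta> - card B"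
    using B_subset finite_B by (intro card_Diff_subset) auto
  moreover have "card B \<le> card \<Delta>" using B_subset finite_\<Delta> by (intro card_mono) auto
  ultimately show ?thesis by (simp add: M_def of_nat_diff)
qed simp

lemma card_common_good:
  assumes "A \<subseteq> B" "finite A" "card A \<le> 4"
  shows "M / 2 \<le> real (card {f \<in> \<Delta>. \<forall>a\<in>A. good a f})"
proof -
  let ?E = "{f \<in> \<Delta>. \<forall>a\<in>A. good a f}"
  have "\<Delta> - ?E \<subseteq> (\<Union>a\<in>A. {f \<in> \<Delta>. \<not> good a f})" by auto
  then have "card (\<Delta> - ?E) \<le> card (\<Union>a\<in>A. {f \<in> \<Delta>. \<not> good a f})"
    using assms by (intro card_mono) (auto simp: finite_\<Delta>)
  also have "\<dots> \<le> (\<Sum>a\<in>A. card {f \<in> \<Delta>. \<not> good a f})" by (rule card_UN_le[OF assms(2)])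
  finally have "real (card (\<Delta> - ?E)) \<le> (\<Sum>a\<in>A. real (card {f \<in> \<Delta>. \<not> good a f}))"
    by (simp only: of_nat_sum[symmetric] of_nat_le_iff)
  also have "\<dots> \<le> real (card A) * (M / 8)"
    using assms by (intro sum_bounded_above) (auto simp: B_def)
  also have "\<dots> \<le> 4 * (M / 8)"
    using assms M_nonneg by (intro mult_right_mono) auto
  finally have "real (card (\<Delta> - ?E)) \<le> M / 2" by simp
  moreover have "card (\<Delta> - ?E) = card \<Delta> - card ?E"
    by (intro card_Diff_subset finite_subset[OF _ finite_\<Delta>]) auto
  moreover have "card ?E \<le> card \<Delta>" by (intro card_mono finite_\<Delta>) auto
  ultimately show ?thesis by (simp add: M_def of_nat_diff)
qed

section \<open>Ratios of differences\<close>

lemma p_big: "3 * N < p"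
proof -
  have "3 * N \<le> N\<^sup>2" using N_ge by (simp add: power2_eq_square mult_right_mono)
  then show ?thesis using N_less by linarith
qed

lemma prime_dvd_mult_cancel: "p dvd a * b \<Longrightarrow> \<not> p dvd a \<Longrightarrow> p dvd b"
  using prime_p prime_dvd_mult_iff by blast

lemma diff_nz:
  assumes "a \<in> \<Delta>" "b \<in> \<Delta>" "a \<noteq> b"
  shows "\<not> p dvd \<gamma> a - \<gamma> b"
proof
  assume "p dvd \<gamma> a - \<gamma> b"
  then have "\<gamma> a \<simeq> \<gamma> b" by (simp add: cong_iff_dvd_diff)
  moreover have "a \<in> {-N..N}" "b \<in> {-N..N}" using assms \<Delta>_range by auto
  ultimately have "a = b" using N_ge by (intro \<gamma>_inj) auto
  with assms show False by simp
qed

text \<open>Quotients of nonzero differences, multiplied out and represented by integers from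
  \<open>1\<close> to \<open>p - 1\<close>, so that subtracting \<open>1\<close> can be handled with
  the order of the integers.\<close>

definition ratios :: "int set" where
  "ratios = {\<xi> \<in> {1..p - 1}. \<exists>x\<in>B. \<exists>x'\<in>B. \<exists>y\<in>B. \<exists>y'\<in>B. x \<noteq> x' \<and> y \<noteq> y' \<and>
     \<gamma> x - \<gamma> x' \<simeq> \<xi> * (\<gamma> y - \<gamma> y')}"

lemma finite_ratios: "finite ratios"
  unfolding ratios_def by (rule finite_subset[of _ "{1..p - 1}"]) auto

lemma ratiosI:
  assumes "\<xi> \<in> {1..p - 1}" "x \<in> B" "x' \<in> B" "y \<in> B" "y' \<in> B" "x \<noteq> x'" "y \<noteq> y'"
    "\<gamma> x - \<gamma> x' \<simeq> \<xi> * (\<gamma> y - \<gamma> y')"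
  shows "\<xi> \<in> ratios"
  using assms unfolding ratios_def by blast

text \<open>Supplies \<open>ratios_exit\<close> with a ratio that lies above every missing
  residue.\<close>

lemma minus_one_in_ratios:
  assumes "x \<in> B" "y \<in> B" "x \<noteq> y"
  shows "p - 1 \<in> ratios"
proof -
  have "(\<gamma> x - \<gamma> y) - (p - 1) * (\<gamma> y - \<gamma> x) = p * (\<gamma> x - \<gamma> y)" by (simp add: algebra_simps)
  then have "\<gamma> x - \<gamma> y \<simeq> (p - 1) * (\<gamma> y - \<gamma> x)" by (simp add: cong_iff_dvd_diff)
  with assms show ?thesis
    using p_big N_ge by (intro ratiosI[of _ x y y x]) auto
qed

text \<open>A set of nonzero residues that contains \<open>-1\<close> but misses some \<open>\<xi>\<^sub>0\<close> is not closed under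
  subtracting \<open>1\<close>.\<close>

lemma ratios_exit:
  assumes "\<xi>\<^sub>0 \<in> {1..p - 2}" "\<xi>\<^sub>0 \<notin> ratios" "p - 1 \<in> ratios"
  obtains r where "r \<in> ratios" "r - 1 \<notin> ratios" "r - 1 \<in> {1..p - 2}"
proof -
  \<comment> \<open>The least ratio that is at least \<open>\<xi>\<^sub>0\<close>. It is not
    \<open>\<xi>\<^sub>0\<close>, so its predecessor is still in range and, by minimality, not a
    ratio.\<close>
  define r where "r = Min (ratios \<inter> {\<xi>\<^sub>0..})"
  have fin: "finite (ratios \<inter> {\<xi>\<^sub>0..})" and ne: "ratios \<inter> {\<xi>\<^sub>0..} \<noteq> {}" using finite_ratios assms by auto
  from Min_in[OF fin ne] have r: "r \<in> ratios" "\<xi>\<^sub>0 \<le> r" by (auto simp: r_def)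
  with assms(2) have less: "\<xi>\<^sub>0 < r" by (cases "r = \<xi>\<^sub>0") auto
  have "r - 1 \<notin> ratios"
  proof
    assume "r - 1 \<in> ratios"
    with less have "r - 1 \<in> ratios \<inter> {\<xi>\<^sub>0..}" by auto
    from Min_le[OF fin this] show False by (simp add: r_def)
  qed
  moreover have "r - 1 \<in> {1..p - 2}" using r less assms(1) by (auto simp: ratios_def)
  ultimately show ?thesis using r that by blast
qed

text \<open>Since \<open>u \<simeq> r * v\<close>, the form equals
  \<open>v * (\<gamma> x + (r - 1) * \<gamma> y)\<close> modulo \<open>p\<close>. Two equal values
  give \<open>\<gamma> x - \<gamma> x' \<simeq> (r - 1) * (\<gamma> y' - \<gamma> y)\<close>. If one
  side vanishes, so does the other; otherwise \<open>r - 1\<close> would be a ratio.\<close>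

lemma pivot_inj:
  assumes r: "r - 1 \<notin> ratios" "r - 1 \<in> {1..p - 2}" and u: "u \<simeq> r * v" and v: "\<not> p dvd v"
    and B: "x \<in> B" "y \<in> B" "x' \<in> B" "y' \<in> B"
    and eq: "v * \<gamma> x + (u - v) * \<gamma> y \<simeq> v * \<gamma> x' + (u - v) * \<gamma> y'"
  shows "x = x' \<and> y = y'"
proof -
  from u obtain k where k: "u = r * v + p * k"
    by (metis cong_iff_lin cong_sym)
  from eq have "p dvd (v * \<gamma> x + (u - v) * \<gamma> y) - (v * \<gamma> x' + (u - v) * \<gamma> y')"
    by (simp add: cong_iff_dvd_diff)
  also have "(v * \<gamma> x + (u - v) * \<gamma> y) - (v * \<gamma> x' + (u - v) * \<gamma> y') =
     v * ((\<gamma> x - \<gamma> x') - (r - 1) * (\<gamma> y' - \<gamma> y)) + p * (k * (\<gamma> y - \<gamma> y'))"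
    unfolding k by (simp add: algebra_simps)
  finally have "p dvd v * ((\<gamma> x - \<gamma> x') - (r - 1) * (\<gamma> y' - \<gamma> y))"
    by (simp add: dvd_add_left_iff)
  with v have *: "p dvd (\<gamma> x - \<gamma> x') - (r - 1) * (\<gamma> y' - \<gamma> y)"
    using prime_dvd_mult_cancel by blast
  have xy: "x \<in> \<Delta>" "y \<in> \<Delta>" "x' \<in> \<Delta>" "y' \<in> \<Delta>" using B B_subset by auto
  show ?thesis
  proof (cases "y = y'")
    case True
    with * have "p dvd \<gamma> x - \<gamma> x'" by simp
    with True diff_nz xy show ?thesis by blast
  next
    case False
    show ?thesis
    proof (cases "x = x'")
      case True
      with * have "p dvd (r - 1) * (\<gamma> y' - \<gamma> y)" by (metis diff_self diff_0 dvd_minus_iff)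
      moreover have "\<not> p dvd r - 1" using r(2) zdvd_not_zless[of "r - 1" p] by auto
      ultimately have "p dvd \<gamma> y' - \<gamma> y" using prime_dvd_mult_cancel by blast
      with False diff_nz xy show ?thesis by blast
    next
      case neq: False
      have "\<gamma> x - \<gamma> x' \<simeq> (r - 1) * (\<gamma> y' - \<gamma> y)" using * by (simp add: cong_iff_dvd_diff)
      then have "r - 1 \<in> ratios"
        using B False neq r(2) by (intro ratiosI[of _ x x' y' y]) auto
      with r(1) show ?thesis by simp
    qed
  qed
qed

section \<open>An upper bound for the number of ratios\<close>

definition four_term_reps :: "int \<Rightarrow> (int \<times> int \<times> int \<times> int) set" where
  "four_term_reps w = {(k1, k2, k3, k4). {k1, k2, k3, k4} \<subseteq> {-2*N..2*N} \<and>
     D * (\<gamma> k1 - \<gamma> k2 - \<gamma> k3 + \<gamma> k4) \<simeq> w}"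

lemma four_term_reps_subset:
  "four_term_reps w \<subseteq> {-2*N..2*N} \<times> {-2*N..2*N} \<times> {-2*N..2*N} \<times> {-2*N..2*N}"
  by (auto simp: four_term_reps_def)

lemma finite_four_term_reps: "finite (four_term_reps w)"
  by (rule finite_subset[OF four_term_reps_subset]) auto

text \<open>For each common good partner \<open>e\<close>, write the difference as
  \<open>(\<gamma> a - \<gamma> e) - (\<gamma> b - \<gamma> e)\<close> and represent both parts in
  at least \<open>\<theta>\<close> ways. By \<open>S_vertex_unique\<close> the labels give back
  \<open>e\<close>, so different choices give different quadruples.\<close>

lemma card_four_term_reps_ge:
  assumes a: "a \<in> B" and b: "b \<in> B" and x: "x \<in> {0..<N}"
  shows "M / 2 * \<theta>\<^sup>2 \<le> real (card (four_term_reps ((\<gamma> a - \<gamma> b) * \<gamma> x)))"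
proof -
  define E where "E = {f \<in> \<Delta>. \<forall>c\<in>{a, b}. good c f}"
  have E: "M / 2 \<le> real (card E)"
    unfolding E_def using a b by (intro card_common_good) (auto intro: order_trans[OF card_insert_le_m1])
  have finE: "finite E" unfolding E_def using finite_\<Delta> by simp
  define X where "X = (SIGMA e:E. S a e \<times> S b e)"
  have "real (card E) * \<theta>\<^sup>2 \<le> real (card X)"
    unfolding X_def
  proof (rule card_Sigma_ge[OF finE])
    fix e assume e: "e \<in> E"
    then have "\<theta> \<le> real (card (S a e))" "\<theta> \<le> real (card (S b e))" by (auto simp: E_def good_def)
    then show "\<theta>\<^sup>2 \<le> real (card (S a e \<times> S b e))"
      using \<theta>_nonneg by (simp add: card_cartesian_product power2_eq_square mult_mono)
  qed (simp add: finite_S)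
  moreover have "M / 2 * \<theta>\<^sup>2 \<le> real (card E) * \<theta>\<^sup>2" using E by (rule mult_right_mono) simp
  moreover have "card X \<le> card (four_term_reps ((\<gamma> a - \<gamma> b) * \<gamma> x))"
  proof (rule card_inj_on_le[of "\<lambda>(e, (s, t), (s', t')). (x + s, x + t, x + s', x + t')"])
    show "inj_on (\<lambda>(e, (s, t), (s', t')). (x + s, x + t, x + s', x + t')) X"
      unfolding X_def E_def by (auto simp: inj_on_def dest: S_vertex_unique)
    show "(\<lambda>(e, (s, t), (s', t')). (x + s, x + t, x + s', x + t')) ` X \<subseteq> four_term_reps ((\<gamma> a - \<gamma> b) * \<gamma> x)"
    proof clarify
      fix e s t s' t' assume "(e, (s, t), (s', t')) \<in> X"
      then have e: "e \<in> \<Delta>" and st: "(s, t) \<in> S a e" and st': "(s', t') \<in> S b e"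
        by (auto simp: X_def E_def)
      have ab: "a \<in> \<Delta>" "b \<in> \<Delta>" using a b B_subset by auto
      have "(\<gamma> a - \<gamma> e) * \<gamma> x - (\<gamma> b - \<gamma> e) * \<gamma> x \<simeq>
        D * (\<gamma> (x + s) - \<gamma> (x + t)) - D * (\<gamma> (x + s') - \<gamma> (x + t'))"
        by (intro cong_diff S_shift st st')
      then have "(\<gamma> a - \<gamma> b) * \<gamma> x \<simeq> D * (\<gamma> (x + s) - \<gamma> (x + t) - \<gamma> (x + s') + \<gamma> (x + t'))"
        by (simp add: algebra_simps)
      then show "(x + s, x + t, x + s', x + t') \<in> four_term_reps ((\<gamma> a - \<gamma> b) * \<gamma> x)"
        using S_range[OF ab(1) e st] S_range[OF ab(2) e st'] x
        by (auto simp: four_term_reps_def cong_sym)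
    qed
  qed (rule finite_four_term_reps)
  ultimately show ?thesis by linarith
qed

definition dilated_diffs :: "int set" where
  "dilated_diffs = (\<lambda>(a, b, x). ((\<gamma> a - \<gamma> b) * \<gamma> x) mod p) ` (B \<times> B \<times> {0..<N})"

lemma finite_dilated_diffs: "finite dilated_diffs" unfolding dilated_diffs_def using finite_B by auto

lemma p_pos: "0 < p" using p_big N_ge by linarith

text \<open>Each value has at least \<open>M / 2 * \<theta>\<^sup>2\<close> four-term
  representations, distinct residues share none, and there are at most \<open>(5 * n) ^ 4\<close>
  quadruples.\<close>

lemma card_dilated_diffs: "real (card dilated_diffs) * M ^ 5 \<le> 8000000 * n ^ 6"
proof -
  have four_term_reps_mod: "four_term_reps (w mod p) = four_term_reps w" for w by (simp add: four_term_reps_def cong_def)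
  have "real (card dilated_diffs) * (M / 2 * \<theta>\<^sup>2) \<le> real (card (Sigma dilated_diffs four_term_reps))"
  proof (rule card_Sigma_ge[OF finite_dilated_diffs finite_four_term_reps])
    fix w assume "w \<in> dilated_diffs"
    then obtain a b x where "a \<in> B" "b \<in> B" "x \<in> {0..<N}" "w = ((\<gamma> a - \<gamma> b) * \<gamma> x) mod p"
      by (auto simp: dilated_diffs_def)
    then show "M / 2 * \<theta>\<^sup>2 \<le> real (card (four_term_reps w))" using card_four_term_reps_ge four_term_reps_mod by simp
  qed
  also have "card (Sigma dilated_diffs four_term_reps) \<le> card ({-2*N..2*N} \<times> {-2*N..2*N} \<times> {-2*N..2*N} \<times> {-2*N..2*N})"
  proof (rule card_inj_on_le[of snd])
    have "w = w'" if "w \<in> dilated_diffs" "w' \<in> dilated_diffs" "k \<in> four_term_reps w" "k \<in> four_term_reps w'" for w w' k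
    proof -
      have "w \<simeq> w'" using that(3,4) unfolding four_term_reps_def by (auto intro: cong_trans cong_sym)
      moreover have "0 \<le> w" "w < p" "0 \<le> w'" "w' < p" using that(1,2) p_pos by (auto simp: dilated_diffs_def)
      ultimately show ?thesis by (simp add: cong_def)
    qed
    then show "inj_on snd (Sigma dilated_diffs four_term_reps)" by (auto simp: inj_on_def)
    show "snd ` Sigma dilated_diffs four_term_reps \<subseteq> {-2*N..2*N} \<times> {-2*N..2*N} \<times> {-2*N..2*N} \<times> {-2*N..2*N}"
    proof (rule image_subsetI)
      fix z assume "z \<in> Sigma dilated_diffs four_term_reps"
      then have "snd z \<in> four_term_reps (fst z)" by auto
      then show "snd z \<in> {-2*N..2*N} \<times> {-2*N..2*N} \<times> {-2*N..2*N} \<times> {-2*N..2*N}"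
        using four_term_reps_subset by (rule rev_subsetD)
    qed
  qed auto
  also have "card ({-2*N..2*N} \<times> {-2*N..2*N} \<times> {-2*N..2*N} \<times> {-2*N..2*N}) = nat (4 * N + 1) ^ 4"
    by (simp add: card_cartesian_product power4_eq_xxxx)
  also have "real (nat (4 * N + 1) ^ 4) \<le> (5 * n) ^ 4"
    unfolding of_nat_power by (rule power_mono) (use N_ge in \<open>auto simp: n_def\<close>)
  finally have "real (card dilated_diffs) * (M / 2 * \<theta>\<^sup>2) \<le> (5 * n) ^ 4" by simp
  then have "real (card dilated_diffs) * (M / 2 * \<theta>\<^sup>2) * (12800 * n\<^sup>2) \<le> (5 * n) ^ 4 * (12800 * n\<^sup>2)"
    by (rule mult_right_mono) simp
  also have "\<dots> = 8000000 * n ^ 6" by (simp add: power_mult_distrib flip: power_add)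
  also have "real (card dilated_diffs) * (M / 2 * \<theta>\<^sup>2) * (12800 * n\<^sup>2) = real (card dilated_diffs) * M ^ 5"
  proof -
    have "\<theta>\<^sup>2 * (6400 * n\<^sup>2) = M ^ 4"
      using n_ge by (simp add: \<theta>_def power_divide power_mult_distrib flip: power_mult)
    moreover have "real (card dilated_diffs) * (M / 2 * \<theta>\<^sup>2) * (12800 * n\<^sup>2) =
        real (card dilated_diffs) * (M * (\<theta>\<^sup>2 * (6400 * n\<^sup>2)))" by simp
    ultimately show ?thesis by (simp flip: power_Suc)
  qed
  finally show ?thesis .
qed

text \<open>A ratio of \<open>u\<close> to \<open>v\<close> yields \<open>N\<close> pairs of dilates
  \<open>(u * \<gamma> t, v * \<gamma> t)\<close> with both entries in \<open>dilated_diffs\<close>.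
  The quotient of such a pair gives back the ratio, and its second entry then gives back
  \<open>t\<close>.\<close>

lemma card_ratios: "real (card ratios) * n \<le> (real (card dilated_diffs))\<^sup>2"
proof -
  define P where "P \<xi> q \<longleftrightarrow> (case q of (x, x', y, y') \<Rightarrow> x \<in> B \<and> x' \<in> B \<and> y \<in> B \<and> y' \<in> B \<and> y \<noteq> y' \<and>
     \<gamma> x - \<gamma> x' \<simeq> \<xi> * (\<gamma> y - \<gamma> y'))" for \<xi> q
  have "\<forall>\<xi>\<in>ratios. \<exists>q. P \<xi> q"
    unfolding ratios_def P_def by auto
  \<comment> \<open>One representation is fixed per ratio, independently of \<open>t\<close>: equal
    ratios then have equal denominators, so that \<open>t\<close> can be read off.\<close>
  then obtain q where q0: "\<forall>\<xi>\<in>ratios. P \<xi> (q \<xi>)" by (rule bchoice[THEN exE])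
  note q = q0[rule_format, unfolded P_def]
  define u where "u \<xi> = (case q \<xi> of (x, x', y, y') \<Rightarrow> \<gamma> x - \<gamma> x')" for \<xi>
  define v where "v \<xi> = (case q \<xi> of (x, x', y, y') \<Rightarrow> \<gamma> y - \<gamma> y')" for \<xi>
  have uv: "u \<xi> \<simeq> \<xi> * v \<xi>" if "\<xi> \<in> ratios" for \<xi>
    using q[OF that] by (auto simp: u_def v_def split: prod.splits)
  have v_nz: "\<not> p dvd v \<xi>" if "\<xi> \<in> ratios" for \<xi>
    using q[OF that] diff_nz B_subset by (auto simp: v_def split: prod.splits)
  have inU: "(u \<xi> * \<gamma> t) mod p \<in> dilated_diffs" "(v \<xi> * \<gamma> t) mod p \<in> dilated_diffs" if "\<xi> \<in> ratios" "t \<in> {0..<N}" for \<xi> t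
    using q[OF that(1)] that(2) by (force simp: u_def v_def dilated_diffs_def split: prod.splits)+
  have "card (ratios \<times> {0..<N}) \<le> card (dilated_diffs \<times> dilated_diffs)"
  proof (rule card_inj_on_le[of "\<lambda>(\<xi>, t). ((u \<xi> * \<gamma> t) mod p, (v \<xi> * \<gamma> t) mod p)"])
    show "inj_on (\<lambda>(\<xi>, t). ((u \<xi> * \<gamma> t) mod p, (v \<xi> * \<gamma> t) mod p)) (ratios \<times> {0..<N})"
    proof (rule inj_onI, clarify)
      fix \<xi> t \<xi>' t' assume R: "\<xi> \<in> ratios" "\<xi>' \<in> ratios" and t: "t \<in> {0..<N}" "t' \<in> {0..<N}"
        and "(u \<xi> * \<gamma> t) mod p = (u \<xi>' * \<gamma> t') mod p" "(v \<xi> * \<gamma> t) mod p = (v \<xi>' * \<gamma> t') mod p"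
      then have eq: "u \<xi> * \<gamma> t \<simeq> u \<xi>' * \<gamma> t'" "v \<xi> * \<gamma> t \<simeq> v \<xi>' * \<gamma> t'" by (auto simp: cong_def)
      have "\<xi> * v \<xi> * \<gamma> t \<simeq> u \<xi> * \<gamma> t" by (intro cong_mult cong_refl cong_sym[OF uv] R)
      also note eq(1)
      also have "u \<xi>' * \<gamma> t' \<simeq> \<xi>' * v \<xi>' * \<gamma> t'" by (intro cong_mult cong_refl uv R)
      also have "\<xi>' * v \<xi>' * \<gamma> t' = \<xi>' * (v \<xi>' * \<gamma> t')" by simp
      also have "\<xi>' * (v \<xi>' * \<gamma> t') \<simeq> \<xi>' * (v \<xi> * \<gamma> t)"
        by (intro cong_mult cong_refl cong_sym[OF eq(2)])
      finally have "(v \<xi> * \<gamma> t) * \<xi> \<simeq> (v \<xi> * \<gamma> t) * \<xi>'" by (simp add: algebra_simps)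
      moreover have "\<not> p dvd v \<xi> * \<gamma> t" using v_nz[OF R(1)] \<gamma>_nz prime_dvd_mult_cancel by blast
      ultimately have "\<xi> \<simeq> \<xi>'" by (rule cancel[rotated])
      moreover have "0 \<le> \<xi>" "\<xi> < p" "0 \<le> \<xi>'" "\<xi>' < p" using R by (auto simp: ratios_def)
      ultimately have \<xi>: "\<xi> = \<xi>'" by (simp add: cong_def)
      have "\<gamma> t \<simeq> \<gamma> t'" by (rule cancel[OF v_nz[OF R(1)]]) (use eq(2) \<xi> in simp)
      then have "t = t'" by (rule \<gamma>_inj) (use t in auto)
      with \<xi> show "\<xi> = \<xi>' \<and> t = t'" by simp
    qed
    show "(\<lambda>(\<xi>, t). ((u \<xi> * \<gamma> t) mod p, (v \<xi> * \<gamma> t) mod p)) ` (ratios \<times> {0..<N}) \<subseteq> dilated_diffs \<times> dilated_diffs"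
      using inU by auto
  qed (use finite_dilated_diffs in auto)
  then have "card ratios * nat N \<le> card dilated_diffs * card dilated_diffs" by (simp add: card_cartesian_product)
  then have "real (card ratios) * real (nat N) \<le> real (card dilated_diffs) * real (card dilated_diffs)"
    by (simp only: of_nat_mult[symmetric] of_nat_le_iff)
  then show ?thesis using N_ge by (simp add: power2_eq_square n_def)
qed

text \<open>There are then at least \<open>p - 2\<close>, hence at least
  \<open>n\<^sup>2 / 2\<close>, ratios. By \<open>card_ratios\<close> this forces many dilated
  differences, and \<open>card_dilated_diffs\<close> allows this only for small
  \<open>M\<close>.\<close>

lemma M_bound_if_ratios_full:
  assumes "{1..p - 2} \<subseteq> ratios"
  shows "M ^ 10 \<le> 2 * 10 ^ 14 * n ^ 9"
proof -
  have "card {1..p - 2} \<le> card ratios" using assms finite_ratios by (rule card_mono[rotated])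
  then have "real_of_int (p - 2) \<le> real (card ratios)" using p_big N_ge by simp
  moreover have "n\<^sup>2 / 2 \<le> real_of_int (p - 2)"
  proof -
    have "N \<le> N\<^sup>2" using N_ge by (intro self_le_power) auto
    then have "2 \<le> N\<^sup>2" using N_ge by linarith
    then have "real_of_int (N\<^sup>2) / 2 \<le> real_of_int (p - 2)" using N_less by linarith
    then show ?thesis by (simp add: n_def)
  qed
  ultimately have "n\<^sup>2 / 2 \<le> real (card ratios)" by linarith
  then have "n\<^sup>2 / 2 * n \<le> real (card ratios) * n" using n_ge by (intro mult_right_mono) auto
  also note card_ratios
  finally have 1: "n ^ 3 / 2 \<le> (real (card dilated_diffs))\<^sup>2" by (simp add: power_numeral_reduce)
  have "n ^ 3 / 2 * (M ^ 5)\<^sup>2 \<le> (real (card dilated_diffs))\<^sup>2 * (M ^ 5)\<^sup>2" using 1 by (rule mult_right_mono) simp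
  also have "\<dots> = (real (card dilated_diffs) * M ^ 5)\<^sup>2" by (simp add: power_mult_distrib)
  also have "\<dots> \<le> (8000000 * n ^ 6)\<^sup>2" using card_dilated_diffs M_nonneg by (intro power_mono) auto
  finally have "n ^ 3 * M ^ 10 \<le> 128000000000000 * n ^ (3 + 9)"
    by (simp add: power_mult_distrib power_mult[symmetric])
  also have "128000000000000 * n ^ (3 + 9) = n ^ 3 * (128000000000000 * n ^ 9)"
    unfolding power_add by (rule mult.left_commute)
  finally have "n ^ 3 * M ^ 10 \<le> n ^ 3 * (128000000000000 * n ^ 9)" .
  then have "M ^ 10 \<le> 128000000000000 * n ^ 9" using n_ge by simp
  also have "\<dots> \<le> 2 * 10 ^ 14 * n ^ 9" using n_ge by simp
  finally show ?thesis .
qed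

section \<open>Coincidences among representations of differences\<close>

definition diff_reps :: "int set \<Rightarrow> (int \<times> int \<times> int \<times> int) set" where
  "diff_reps E = {(f, f', q, k). f \<in> E \<and> f' \<in> E \<and> q \<in> {-2*N..N} \<and> k \<in> {-2*N..N} \<and>
     \<gamma> f - \<gamma> f' \<simeq> D * (\<gamma> q - \<gamma> k)}"

lemma diff_reps_subset: "diff_reps E \<subseteq> E \<times> E \<times> {-2*N..N} \<times> {-2*N..N}"
  by (auto simp: diff_reps_def)

lemma finite_diff_reps: "E \<subseteq> \<Delta> \<Longrightarrow> finite (diff_reps E)"
  by (rule finite_subset[OF diff_reps_subset]) (auto intro: finite_subset[OF _ finite_\<Delta>])

text \<open>Cauchy-Schwarz for \<open>f - \<delta>\<close> on \<open>E \<times> \<Delta>\<close>,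
  which takes at most \<open>5 * n\<close> values. A collision
  \<open>f - \<delta> = f' - \<delta>'\<close> is a common neighbour and yields an element of
  \<open>S f f'\<close>.\<close>

lemma card_diff_reps_ge:
  assumes E: "E \<subseteq> \<Delta>"
  shows "(real (card E) * M)\<^sup>2 \<le> 5 * n * real (card (diff_reps E))"
proof -
  have finE: "finite E" using E finite_\<Delta> finite_subset by blast
  define C where "C = collisions (E \<times> \<Delta>) (\<lambda>(f, \<delta>). f - \<delta>)"
  have "(real (card (E \<times> \<Delta>)))\<^sup>2 \<le> real (card {-2*N..2*N}) * real (card C)"
    unfolding C_def
  proof (rule card_collisions_ge)
    show "(\<lambda>(f, \<delta>). f - \<delta>) ` (E \<times> \<Delta>) \<subseteq> {-2*N..2*N}"
    proof clarify
      fix f \<delta> assume "f \<in> E" "\<delta> \<in> \<Delta>"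
      then have "f \<in> {-N..N}" "\<delta> \<in> {-N..N}" using E \<Delta>_range by auto
      then show "f - \<delta> \<in> {-2*N..2*N}" by auto
    qed
  qed (use finE finite_\<Delta> in auto)
  also have "\<dots> \<le> 5 * n * real (card (diff_reps E))"
  proof (rule mult_mono)
    show "real (card {-2*N..2*N}) \<le> 5 * n" using N_ge by (simp add: n_def)
    have "card C \<le> card (diff_reps E)"
    proof (rule card_inj_on_le[of "\<lambda>((f, \<delta>), (f', \<delta>')). (f, f', f - \<phi> \<delta>, f' - \<phi> \<delta>')"])
      show "inj_on (\<lambda>((f, \<delta>), (f', \<delta>')). (f, f', f - \<phi> \<delta>, f' - \<phi> \<delta>')) C"
        using \<phi>_inj by (auto simp: C_def collisions_def inj_on_def)
      show "(\<lambda>((f, \<delta>), (f', \<delta>')). (f, f', f - \<phi> \<delta>, f' - \<phi> \<delta>')) ` C \<subseteq> diff_reps E"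
      proof clarify
        fix f \<delta> f' \<delta>' assume "((f, \<delta>), (f', \<delta>')) \<in> C"
        then have *: "f \<in> E" "f' \<in> E" "\<delta> \<in> \<Delta>" "\<delta>' \<in> \<Delta>" "f - \<delta> = f' - \<delta>'"
          by (auto simp: C_def collisions_def)
        have S: "(f - \<phi> \<delta>, f' - \<phi> \<delta>') \<in> S f f'"
          unfolding S_def using * by (intro image_eqI[of _ _ "(\<delta>, \<delta>')"]) auto
        have f: "f \<in> \<Delta>" "f' \<in> \<Delta>" using * E by auto
        from S_cong[OF S] S_range[OF f S] * show "(f, f', f - \<phi> \<delta>, f' - \<phi> \<delta>') \<in> diff_reps E"
          by (auto simp: diff_reps_def)
      qed
    qed (rule finite_diff_reps[OF E])
    then show "real (card C) \<le> real (card (diff_reps E))" by simp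
  qed (use n_ge in auto)
  finally show ?thesis by (simp add: card_cartesian_product M_def)
qed

lemma diff_reps_unique:
  assumes "(f, f', q, k) \<in> diff_reps E" "(f, f', q, k') \<in> diff_reps E"
  shows "k = k'"
proof -
  have "D * (\<gamma> q - \<gamma> k) \<simeq> D * (\<gamma> q - \<gamma> k')"
    using assms unfolding diff_reps_def by (auto intro: cong_trans cong_sym)
  then have "\<gamma> q - \<gamma> k \<simeq> \<gamma> q - \<gamma> k'" by (rule cancel[OF D_nz])
  then have "\<gamma> q - (\<gamma> q - \<gamma> k) \<simeq> \<gamma> q - (\<gamma> q - \<gamma> k')" by (rule cong_diff[OF cong_refl])
  then have "\<gamma> k \<simeq> \<gamma> k'" by simp
  then show ?thesis by (rule \<gamma>_inj) (use assms in \<open>auto simp: diff_reps_def\<close>)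
qed

text \<open>Subtracting two representations with the same \<open>k\<close> removes
  \<open>\<gamma> k\<close>: a signed sum of four powers with exponents in \<open>E\<close> becomes
  \<open>D\<close> times a difference of only two powers (\<open>rep_pairs_cong\<close>).\<close>

definition rep_pairs :: "int set \<Rightarrow> ((int \<times> int \<times> int \<times> int) \<times> (int \<times> int \<times> int \<times> int)) set" where
  "rep_pairs E = collisions (diff_reps E) (\<lambda>(f, f', q, k). k)"

lemma finite_rep_pairs: "E \<subseteq> \<Delta> \<Longrightarrow> finite (rep_pairs E)"
  unfolding rep_pairs_def by (intro finite_collisions finite_diff_reps)

text \<open>A second Cauchy-Schwarz, over the at most \<open>4 * n\<close> values of
  \<open>k\<close>, on top of \<open>card_diff_reps_ge\<close>.\<close>

lemma card_rep_pairs_ge: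
  assumes E: "E \<subseteq> \<Delta>"
  shows "real (card E) ^ 4 * M ^ 4 \<le> 100 * n ^ 3 * real (card (rep_pairs E))"
proof -
  have "(real (card (diff_reps E)))\<^sup>2 \<le> real (card {-2*N..N}) * real (card (rep_pairs E))"
    unfolding rep_pairs_def by (rule card_collisions_ge) (use finite_diff_reps[OF E] in \<open>auto simp: diff_reps_def\<close>)
  also have "\<dots> \<le> 4 * n * real (card (rep_pairs E))"
    by (rule mult_right_mono) (use N_ge in \<open>auto simp: n_def\<close>)
  finally have 1: "(real (card (diff_reps E)))\<^sup>2 \<le> 4 * n * real (card (rep_pairs E))" .
  have "((real (card E) * M)\<^sup>2)\<^sup>2 \<le> (5 * n * real (card (diff_reps E)))\<^sup>2"
    by (rule power_mono[OF card_diff_reps_ge[OF E]]) simp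
  also have "\<dots> = (25 * n\<^sup>2) * (real (card (diff_reps E)))\<^sup>2" by (simp add: power_mult_distrib)
  also have "\<dots> \<le> (25 * n\<^sup>2) * (4 * n * real (card (rep_pairs E)))" by (rule mult_left_mono[OF 1]) simp
  also have "\<dots> = 100 * n ^ 3 * real (card (rep_pairs E))" by (simp add: power_numeral_reduce)
  finally show ?thesis by (simp add: power_mult_distrib flip: power_mult)
qed

text \<open>The prescribed exponent is the third of the four, the one that
  \<open>block_identity\<close> pairs with \<open>b1\<close> in the coefficient of
  \<open>\<gamma> y\<close>.\<close>

definition rep_pairs_at :: "int set \<Rightarrow> int \<Rightarrow> ((int \<times> int \<times> int \<times> int) \<times> (int \<times> int \<times> int \<times> int)) set" where
  "rep_pairs_at E f = {(w, w') \<in> rep_pairs E. fst w' = f}"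

lemma finite_rep_pairs_at: "E \<subseteq> \<Delta> \<Longrightarrow> finite (rep_pairs_at E f)"
  by (rule finite_subset[OF _ finite_rep_pairs[of E]]) (auto simp: rep_pairs_at_def)

text \<open>The lower bound for \<^const>\<open>rep_pairs\<close> applies to every subset of \<open>E\<close>, in particular to the set of the
  \<open>f\<close> that have few partners; hence this set is small.\<close>

lemma card_popular_ge:
  assumes E: "E \<subseteq> \<Delta>"
  shows "real (card E) \<le>
    2 * real (card {f \<in> E. real (card E) ^ 3 * M ^ 4 \<le> 800 * n ^ 3 * real (card (rep_pairs_at E f))})"
proof -
  define E' where "E' = {f \<in> E. real (card E) ^ 3 * M ^ 4 \<le> 800 * n ^ 3 * real (card (rep_pairs_at E f))}"
  define L where "L = E - E'"
  have fin: "finite E" "finite L" using E finite_\<Delta> finite_subset unfolding L_def by auto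
  have L\<Delta>: "L \<subseteq> \<Delta>" using E by (auto simp: L_def)
  have "2 * card L \<le> card E"
  proof (rule ccontr)
    assume "\<not> ?thesis"
    then have gt: "card E < 2 * card L" by simp
    then have "L \<noteq> {}" by auto
    then have "\<Delta> \<noteq> {}" using L\<Delta> by auto
    then have M: "M > 0" using finite_\<Delta> by (simp add: M_def card_gt_0_iff)
    \<comment> \<open>A pair from \<open>rep_pairs L\<close> has its third exponent in
      \<open>L\<close>, where \<open>rep_pairs_at E\<close> is small.\<close>
    have "rep_pairs L \<subseteq> (\<Union>f\<in>L. rep_pairs_at E f)"
      by (auto simp: rep_pairs_def rep_pairs_at_def collisions_def diff_reps_def L_def)
    then have "card (rep_pairs L) \<le> card (\<Union>f\<in>L. rep_pairs_at E f)"
      using fin finite_rep_pairs_at[OF E] by (intro card_mono) auto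
    also have "\<dots> \<le> (\<Sum>f\<in>L. card (rep_pairs_at E f))" by (rule card_UN_le[OF fin(2)])
    finally have "real (card (rep_pairs L)) \<le> (\<Sum>f\<in>L. real (card (rep_pairs_at E f)))"
      by (simp only: of_nat_sum[symmetric] of_nat_le_iff)
    also have "\<dots> \<le> real (card L) * (real (card E) ^ 3 * M ^ 4 / (800 * n ^ 3))"
    proof (rule sum_bounded_above)
      fix f assume "f \<in> L"
      then have "800 * n ^ 3 * real (card (rep_pairs_at E f)) \<le> real (card E) ^ 3 * M ^ 4"
        by (auto simp: L_def E'_def)
      then show "real (card (rep_pairs_at E f)) \<le> real (card E) ^ 3 * M ^ 4 / (800 * n ^ 3)"
        using n_ge by (simp add: field_simps)
    qed
    finally have "100 * n ^ 3 * real (card (rep_pairs L)) \<le>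
        100 * n ^ 3 * (real (card L) * (real (card E) ^ 3 * M ^ 4 / (800 * n ^ 3)))"
      using n_ge by (intro mult_left_mono) auto
    also have "\<dots> = real (card L) * M ^ 4 * (real (card E) ^ 3 / 8)" using n_ge by simp
    \<comment> \<open>Here \<open>800 = 100 * 2 ^ 3\<close> matters: the two bounds together give
      \<open>card L ^ 3 \<le> card E ^ 3 / 8\<close>, although \<open>L\<close> is more than half of
      \<open>E\<close>.\<close>
    finally have "real (card L) ^ 4 * M ^ 4 \<le> real (card L) * M ^ 4 * (real (card E) ^ 3 / 8)"
      using card_rep_pairs_ge[OF L\<Delta>] by linarith
    also have "real (card L) ^ 4 * M ^ 4 = real (card L) * M ^ 4 * real (card L) ^ 3"
      by (simp add: power_numeral_reduce)
    finally have "real (card L) ^ 3 \<le> real (card E) ^ 3 / 8"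
      using M gt by (subst (asm) mult_le_cancel_left_pos) auto
    then have "(2 * real (card L)) ^ 3 \<le> real (card E) ^ 3" by (simp add: power_mult_distrib)
    then have "2 * real (card L) \<le> real (card E)" by (rule power_mono_iff[THEN iffD1, rotated 3]) auto
    with gt show False by simp
  qed
  moreover have "card L = card E - card E'"
    unfolding L_def by (rule card_Diff_subset) (use fin in \<open>auto simp: E'_def\<close>)
  moreover have "card E' \<le> card E" using fin by (intro card_mono) (auto simp: E'_def)
  ultimately have "card E \<le> 2 * card E'" by linarith
  then show ?thesis unfolding E'_def by linarith
qed

section \<open>Representations of the pivot form\<close>

lemma rep_pairs_cong:
  assumes "((f1, f2, q, k), (f3, f4, q', k')) \<in> rep_pairs E"
  shows "\<gamma> f1 - \<gamma> f2 - \<gamma> f3 + \<gamma> f4 \<simeq> D * (\<gamma> q - \<gamma> q')"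
proof -
  have 1: "\<gamma> f1 - \<gamma> f2 \<simeq> D * (\<gamma> q - \<gamma> k)" "\<gamma> f3 - \<gamma> f4 \<simeq> D * (\<gamma> q' - \<gamma> k)"
    using assms by (auto simp: rep_pairs_def collisions_def diff_reps_def)
  have "(\<gamma> f1 - \<gamma> f2) - (\<gamma> f3 - \<gamma> f4) \<simeq> D * (\<gamma> q - \<gamma> k) - D * (\<gamma> q' - \<gamma> k)"
    by (intro cong_diff 1)
  then show ?thesis by (simp add: algebra_simps)
qed

lemma \<gamma>_mult_shift: "D * (\<gamma> q - \<gamma> q') * \<gamma> y \<simeq> D * (\<gamma> (y + q) - \<gamma> (y + q'))"
proof -
  have "D * (\<gamma> q - \<gamma> q') * \<gamma> y = D * (\<gamma> y * \<gamma> q - \<gamma> y * \<gamma> q')" by (simp add: algebra_simps)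
  also have "\<dots> \<simeq> D * (\<gamma> (y + q) - \<gamma> (y + q'))"
    by (intro cong_mult cong_diff cong_refl cong_sym[OF \<gamma>_add])
  finally show ?thesis .
qed

text \<open>In the coefficient of \<open>\<gamma> x\<close>, both \<open>b1\<close> and
  \<open>b2\<close> are compared with \<open>e\<close>, which cancels. In that of
  \<open>\<gamma> y\<close>, the exponents \<open>a1\<close>, \<open>a2\<close>, \<open>b1\<close>,
  \<open>b2\<close> are compared with \<open>f1\<close> to \<open>f4\<close>, whose combination is
  \<open>D\<close> times two powers by \<open>rep_pairs_cong\<close>. This makes fourteen terms. As
  \<open>b1\<close> has opposite signs in the two coefficients, \<open>link\<close> cancels one term
  of each block, leaving twelve.\<close>

lemma block_identity:
  assumes v1: "(s1, t1) \<in> S b1 e" and v2: "(s2, t2) \<in> S b2 e"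
    and y1: "(\<sigma>1, \<tau>1) \<in> S a1 f1" and y2: "(\<sigma>2, \<tau>2) \<in> S a2 f2"
    and y3: "(s3, t3) \<in> S b1 f3" and y4: "(\<sigma>4, \<tau>4) \<in> S b2 f4"
    and J: "((f1, f2, q, k), (f3, f4, q', k')) \<in> rep_pairs E"
    and link: "x + s1 = y + s3"
  shows "(\<gamma> b1 - \<gamma> b2) * \<gamma> x + ((\<gamma> a1 - \<gamma> a2) - (\<gamma> b1 - \<gamma> b2)) * \<gamma> y \<simeq>
    D * (- \<gamma> (x + t1) - \<gamma> (x + s2) + \<gamma> (x + t2)
      + \<gamma> (y + \<sigma>1) - \<gamma> (y + \<tau>1) - \<gamma> (y + \<sigma>2) + \<gamma> (y + \<tau>2)
      + \<gamma> (y + t3) + \<gamma> (y + \<sigma>4) - \<gamma> (y + \<tau>4) + \<gamma> (y + q) - \<gamma> (y + q'))"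
proof -
  have inner: "(\<gamma> f1 - \<gamma> f2 - \<gamma> f3 + \<gamma> f4) * \<gamma> y \<simeq> D * (\<gamma> (y + q) - \<gamma> (y + q'))"
    by (rule cong_trans[OF cong_mult[OF rep_pairs_cong[OF J] cong_refl] \<gamma>_mult_shift])
  have "(\<gamma> b1 - \<gamma> b2) * \<gamma> x + ((\<gamma> a1 - \<gamma> a2) - (\<gamma> b1 - \<gamma> b2)) * \<gamma> y =
      (\<gamma> b1 - \<gamma> e) * \<gamma> x - (\<gamma> b2 - \<gamma> e) * \<gamma> x
      + ((\<gamma> a1 - \<gamma> f1) * \<gamma> y - (\<gamma> a2 - \<gamma> f2) * \<gamma> y
      - (\<gamma> b1 - \<gamma> f3) * \<gamma> y + (\<gamma> b2 - \<gamma> f4) * \<gamma> y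
      + (\<gamma> f1 - \<gamma> f2 - \<gamma> f3 + \<gamma> f4) * \<gamma> y)"
    by (simp add: algebra_simps)
  moreover have "(\<gamma> b1 - \<gamma> e) * \<gamma> x - (\<gamma> b2 - \<gamma> e) * \<gamma> x
      + ((\<gamma> a1 - \<gamma> f1) * \<gamma> y - (\<gamma> a2 - \<gamma> f2) * \<gamma> y
      - (\<gamma> b1 - \<gamma> f3) * \<gamma> y + (\<gamma> b2 - \<gamma> f4) * \<gamma> y
      + (\<gamma> f1 - \<gamma> f2 - \<gamma> f3 + \<gamma> f4) * \<gamma> y) \<simeq>
      D * (\<gamma> (x + s1) - \<gamma> (x + t1)) - D * (\<gamma> (x + s2) - \<gamma> (x + t2))
      + (D * (\<gamma> (y + \<sigma>1) - \<gamma> (y + \<tau>1)) - D * (\<gamma> (y + \<sigma>2) - \<gamma> (y + \<tau>2))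
      - D * (\<gamma> (y + s3) - \<gamma> (y + t3)) + D * (\<gamma> (y + \<sigma>4) - \<gamma> (y + \<tau>4))
      + D * (\<gamma> (y + q) - \<gamma> (y + q')))"
    by (intro cong_add cong_diff S_shift[OF v1] S_shift[OF v2] S_shift[OF y1] S_shift[OF y2]
        S_shift[OF y3] S_shift[OF y4] inner)
  moreover have "D * (\<gamma> (x + s1) - \<gamma> (x + t1)) - D * (\<gamma> (x + s2) - \<gamma> (x + t2))
      + (D * (\<gamma> (y + \<sigma>1) - \<gamma> (y + \<tau>1)) - D * (\<gamma> (y + \<sigma>2) - \<gamma> (y + \<tau>2))
      - D * (\<gamma> (y + s3) - \<gamma> (y + t3)) + D * (\<gamma> (y + \<sigma>4) - \<gamma> (y + \<tau>4))
      + D * (\<gamma> (y + q) - \<gamma> (y + q'))) = D * (- \<gamma> (x + t1) - \<gamma> (x + s2) + \<gamma> (x + t2)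
      + \<gamma> (y + \<sigma>1) - \<gamma> (y + \<tau>1) - \<gamma> (y + \<sigma>2) + \<gamma> (y + \<tau>2)
      + \<gamma> (y + t3) + \<gamma> (y + \<sigma>4) - \<gamma> (y + \<tau>4) + \<gamma> (y + q) - \<gamma> (y + q'))"
    unfolding link by (simp add: right_diff_distrib distrib_left)
  ultimately show ?thesis by (simp only:)
qed

text \<open>
  A point of \<open>\<Omega>\<close> below consists of \<open>x\<close>, \<open>y\<close> and the data of \<open>block_identity\<close>. The term that cancels
  there belongs to \<open>b1\<close> in both blocks, so that the number of cancellations is a sum of squares and
  can be bounded from below.
\<close>

lemma M_bound_if_pivot:
  assumes a: "a1 \<in> B" "a2 \<in> B" and b: "b1 \<in> B" "b2 \<in> B" "b1 \<noteq> b2"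
    and u: "\<gamma> a1 - \<gamma> a2 \<simeq> r * (\<gamma> b1 - \<gamma> b2)"
    and r: "r - 1 \<notin> ratios" "r - 1 \<in> {1..p - 2}"
  shows "M ^ 23 \<le> 10 ^ 28 * n ^ 22"
proof -
  define E where "E = {f \<in> \<Delta>. \<forall>c\<in>{a1, a2, b1, b2}. good c f}"
  have E\<Delta>: "E \<subseteq> \<Delta>" by (auto simp: E_def)
  have finE: "finite E" using E\<Delta> finite_\<Delta> finite_subset by blast
  have cardE: "M / 2 \<le> real (card E)"
    unfolding E_def using a b by (intro card_common_good) (auto simp: card_insert_if)
  have ab\<Delta>: "a1 \<in> \<Delta>" "a2 \<in> \<Delta>" "b1 \<in> \<Delta>" "b2 \<in> \<Delta>" using a b B_subset by auto
  have goodE: "\<theta> \<le> real (card (S c f))" if "f \<in> E" "c \<in> {a1, a2, b1, b2}" for c f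
    using that by (auto simp: E_def good_def)
  define E' where "E' = {f \<in> E. real (card E) ^ 3 * M ^ 4 \<le> 800 * n ^ 3 * real (card (rep_pairs_at E f))}"
  have E'E: "E' \<subseteq> E" by (auto simp: E'_def)
  have finE': "finite E'" using E'E finE finite_subset by blast
  have cardE': "M / 4 \<le> real (card E')"
    using card_popular_ge[OF E\<Delta>] cardE unfolding E'_def by linarith

  \<comment> \<open>A collision of \<open>key\<close> on \<open>H\<close> consists of
    \<open>(x, e, s1, t1)\<close> and \<open>(y, f3, s3, t3)\<close> with
    \<open>x + s1 = y + s3\<close>, which is \<open>link\<close> in \<open>block_identity\<close>.
    Drawing from \<open>E'\<close> ensures that \<open>f3\<close> has many partners in
    \<open>rep_pairs_at\<close>.\<close>
  define H where "H = (SIGMA x:B. SIGMA e:E'. S b1 e)"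
  define key :: "int \<times> int \<times> int \<times> int \<Rightarrow> int" where "key = (\<lambda>(x, e, s, t). x + s)"
  \<comment> \<open>The three projections of \<open>J\<close> are \<open>f1\<close>,
    \<open>f2\<close> and \<open>f4\<close>; the parameter \<open>f\<close> is
    \<open>f3\<close>.\<close>
  define Rest where "Rest f = (SIGMA J:rep_pairs_at E f.
     S a1 (fst (fst J)) \<times> S a2 (fst (snd (fst J))) \<times> S b2 (fst (snd (snd J))))" for f
  define \<Omega> where "\<Omega> = (SIGMA h:collisions H key. S b2 (fst (snd (fst h))) \<times> Rest (fst (snd (snd h))))"

  have finH: "finite H" unfolding H_def by (intro finite_SigmaI finite_B finE' finite_S)
  have finRest: "finite (Rest f)" for f
    unfolding Rest_def by (intro finite_SigmaI finite_cartesian_product finite_S finite_rep_pairs_at[OF E\<Delta>])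

  have cardH: "M / 2 * (M / 4 * \<theta>) \<le> real (card H)"
  proof -
    have "M / 4 * \<theta> \<le> real (card (SIGMA e:E'. S b1 e))"
    proof -
      have "M / 4 * \<theta> \<le> real (card E') * \<theta>" by (rule mult_right_mono[OF cardE' \<theta>_nonneg])
      also have "\<dots> \<le> real (card (SIGMA e:E'. S b1 e))"
        by (rule card_Sigma_ge[OF finE' finite_S]) (use goodE E'E in auto)
      finally show ?thesis .
    qed
    then have "real (card B) * (M / 4 * \<theta>) \<le> real (card H)"
      unfolding H_def using finE' finite_S by (intro card_Sigma_ge[OF finite_B]) auto
    moreover have "M / 2 * (M / 4 * \<theta>) \<le> real (card B) * (M / 4 * \<theta>)"
      by (rule mult_right_mono[OF card_B]) (use M_nonneg \<theta>_nonneg in auto)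
    ultimately show ?thesis by linarith
  qed
  have cardC: "(real (card H))\<^sup>2 \<le> 6 * n * real (card (collisions H key))"
  proof -
    have "(real (card H))\<^sup>2 \<le> real (card {-3*N..2*N}) * real (card (collisions H key))"
    proof (rule card_collisions_ge[OF finH])
      show "key ` H \<subseteq> {-3*N..2*N}"
      proof clarify
        fix x e s t assume "(x, e, s, t) \<in> H"
        then have "x \<in> B" "e \<in> \<Delta>" "(s, t) \<in> S b1 e" using E'E E\<Delta> by (auto simp: H_def)
        moreover from this have "x \<in> {-N..N}" using B_subset \<Delta>_range by auto
        ultimately show "key (x, e, s, t) \<in> {-3*N..2*N}"
          using S_range[OF ab\<Delta>(3)] by (fastforce simp: key_def)
      qed
    qed simp
    also have "\<dots> \<le> 6 * n * real (card (collisions H key))"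
      by (rule mult_right_mono) (use N_ge in \<open>auto simp: n_def\<close>)
    finally show ?thesis .
  qed
  have cardRest: "real (card E) ^ 3 * M ^ 4 / (800 * n ^ 3) * \<theta> ^ 3 \<le> real (card (Rest f))" if "f \<in> E'" for f
  proof -
    have "real (card E) ^ 3 * M ^ 4 / (800 * n ^ 3) \<le> real (card (rep_pairs_at E f))"
      using that n_ge by (simp add: E'_def field_simps)
    then have "real (card E) ^ 3 * M ^ 4 / (800 * n ^ 3) * \<theta> ^ 3 \<le> real (card (rep_pairs_at E f)) * \<theta> ^ 3"
      by (rule mult_right_mono) (simp add: \<theta>_nonneg)
    also have "\<dots> \<le> real (card (Rest f))"
      unfolding Rest_def
    proof (rule card_Sigma_ge[OF finite_rep_pairs_at[OF E\<Delta>]])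
      fix J assume "J \<in> rep_pairs_at E f"
      then have "fst (fst J) \<in> E" "fst (snd (fst J)) \<in> E" "fst (snd (snd J)) \<in> E"
        by (auto simp: rep_pairs_at_def rep_pairs_def collisions_def diff_reps_def)
      then have "\<theta> \<le> real (card (S a1 (fst (fst J))))" "\<theta> \<le> real (card (S a2 (fst (snd (fst J)))))"
        "\<theta> \<le> real (card (S b2 (fst (snd (snd J)))))"
        using goodE by auto
      then have "\<theta> * (\<theta> * \<theta>) \<le> real (card (S a1 (fst (fst J)))) *
        (real (card (S a2 (fst (snd (fst J))))) * real (card (S b2 (fst (snd (snd J))))))"
        using \<theta>_nonneg by (intro mult_mono) auto
      then show "\<theta> ^ 3 \<le> real (card (S a1 (fst (fst J)) \<times> S a2 (fst (snd (fst J))) \<times> S b2 (fst (snd (snd J)))))"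
        by (simp add: card_cartesian_product power3_eq_cube mult.assoc)
    qed (simp add: finite_S)
    finally show ?thesis .
  qed
  have lower: "real (card (collisions H key)) *
     (\<theta> * (real (card E) ^ 3 * M ^ 4 / (800 * n ^ 3) * \<theta> ^ 3)) \<le> real (card \<Omega>)"
    unfolding \<Omega>_def
  proof (rule card_Sigma_ge[OF finite_collisions[OF finH]])
    fix h assume "h \<in> collisions H key"
    then have "fst (snd (fst h)) \<in> E'" "fst (snd (snd h)) \<in> E'"
      by (auto simp: collisions_def H_def)
    then have "\<theta> \<le> real (card (S b2 (fst (snd (fst h)))))"
      "real (card E) ^ 3 * M ^ 4 / (800 * n ^ 3) * \<theta> ^ 3 \<le> real (card (Rest (fst (snd (snd h)))))"
      using goodE E'E cardRest by auto
    then show "\<theta> * (real (card E) ^ 3 * M ^ 4 / (800 * n ^ 3) * \<theta> ^ 3) \<le>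
       real (card (S b2 (fst (snd (fst h))) \<times> Rest (fst (snd (snd h)))))"
      unfolding card_cartesian_product of_nat_mult
      using \<theta>_nonneg n_ge M_nonneg by (intro mult_mono) auto
  qed (simp add: finite_S finRest)

  \<comment> \<open>Contains all sums of an exponent in \<open>{-N..N}\<close> and a label in
    \<open>{-2*N..N}\<close>.\<close>
  define W where "W = {-3*N..2*N}"
  \<comment> \<open>The twelve exponents that survive in \<open>block_identity\<close>; the
    cancelled labels \<open>s1\<close>, \<open>s3\<close> and the auxiliary exponents are left
    out.\<close>
  define out where "out = (\<lambda>(((x :: int, e :: int, s1 :: int, t1), (y :: int, f3 :: int, s3 :: int, t3)), ((s2, t2),
      (((f1 :: int, f2 :: int, q, k :: int), (f :: int, f4 :: int, q', k' :: int)),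
       (\<sigma>1, \<tau>1), (\<sigma>2, \<tau>2), (\<sigma>4, \<tau>4)))).
      (x + t1, x + s2, x + t2, y + \<sigma>1, y + \<tau>1, y + \<sigma>2, y + \<tau>2, y + t3, y + \<sigma>4, y + \<tau>4, y + q, y + q'))"
  have \<Omega>D: "x \<in> B \<and> y \<in> B \<and> e \<in> \<Delta> \<and> f1 \<in> \<Delta> \<and> f2 \<in> \<Delta> \<and> f3 \<in> \<Delta> \<and> f4 \<in> \<Delta> \<and> f = f3 \<and> k' = k \<and>
      q \<in> {-2*N..N} \<and> q' \<in> {-2*N..N} \<and> x + s1 = y + s3 \<and>
      (s1, t1) \<in> S b1 e \<and> (s2, t2) \<in> S b2 e \<and> (\<sigma>1, \<tau>1) \<in> S a1 f1 \<and> (\<sigma>2, \<tau>2) \<in> S a2 f2 \<and>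
      (s3, t3) \<in> S b1 f3 \<and> (\<sigma>4, \<tau>4) \<in> S b2 f4 \<and> (f1, f2, q, k) \<in> diff_reps E \<and>
      ((f1, f2, q, k), (f3, f4, q', k')) \<in> rep_pairs E"
    if "(((x, e, s1, t1), (y, f3, s3, t3)), ((s2, t2),
      (((f1, f2, q, k), (f, f4, q', k')), (\<sigma>1, \<tau>1), (\<sigma>2, \<tau>2), (\<sigma>4, \<tau>4)))) \<in> \<Omega>"
    for x e s1 t1 y f3 s3 t3 s2 t2 f1 f2 q k f f4 q' k' \<sigma>1 \<tau>1 \<sigma>2 \<tau>2 \<sigma>4 \<tau>4
  proof -
    from that have c: "((x, e, s1, t1), (y, f3, s3, t3)) \<in> collisions H key"
      and s2: "(s2, t2) \<in> S b2 e" and R: "(((f1, f2, q, k), (f, f4, q', k')), (\<sigma>1, \<tau>1), (\<sigma>2, \<tau>2), (\<sigma>4, \<tau>4)) \<in> Rest f3"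
      unfolding \<Omega>_def by auto
    from R have J: "((f1, f2, q, k), (f, f4, q', k')) \<in> rep_pairs_at E f3"
      and st: "(\<sigma>1, \<tau>1) \<in> S a1 f1" "(\<sigma>2, \<tau>2) \<in> S a2 f2" "(\<sigma>4, \<tau>4) \<in> S b2 f4"
      unfolding Rest_def by auto
    from J have f: "f = f3" and rep_pairs: "((f1, f2, q, k), (f, f4, q', k')) \<in> rep_pairs E" by (auto simp: rep_pairs_at_def)
    from rep_pairs have X: "(f1, f2, q, k) \<in> diff_reps E" "(f, f4, q', k') \<in> diff_reps E" "k' = k"
      by (auto simp: rep_pairs_def collisions_def)
    from X have "f1 \<in> E" "f2 \<in> E" "f4 \<in> E" "q \<in> {-2*N..N}" "q' \<in> {-2*N..N}"
      by (auto simp: diff_reps_def)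
    moreover from c have "x \<in> B" "y \<in> B" "e \<in> E" "f3 \<in> E" "(s1, t1) \<in> S b1 e" "(s3, t3) \<in> S b1 f3"
        "x + s1 = y + s3"
      using E'E by (auto simp: collisions_def H_def key_def)
    ultimately show ?thesis using E\<Delta> X rep_pairs f st s2 by (auto simp only: subsetD)
  qed
  have upper: "card \<Omega> \<le> card (W \<times> W \<times> W \<times> W \<times> W \<times> W \<times> W \<times> W \<times> W \<times> W \<times> W \<times> W)"
  proof (rule card_inj_on_le[of out])
    show "inj_on out \<Omega>"
proof (rule inj_onI)
      fix w w' assume w: "w \<in> \<Omega>" and w': "w' \<in> \<Omega>" and out_eq: "out w = out w'"
      obtain x e s1 t1 y f3 s3 t3 s2 t2 f1 f2 q k f f4 q' k' \<sigma>1 \<tau>1 \<sigma>2 \<tau>2 \<sigma>4 \<tau>4 where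
        w_eq: "w = (((x, e, s1, t1), (y, f3, s3, t3)), ((s2, t2),
          (((f1, f2, q, k), (f, f4, q', k')), (\<sigma>1, \<tau>1), (\<sigma>2, \<tau>2), (\<sigma>4, \<tau>4))))"
        by (metis surj_pair)
      obtain x\<^sub>2 e\<^sub>2 s1\<^sub>2 t1\<^sub>2 y\<^sub>2 f3\<^sub>2 s3\<^sub>2 t3\<^sub>2 s2\<^sub>2 t2\<^sub>2 f1\<^sub>2 f2\<^sub>2 q\<^sub>2 k\<^sub>2 f\<^sub>2 f4\<^sub>2 q'\<^sub>2 k'\<^sub>2 \<sigma>1\<^sub>2 \<tau>1\<^sub>2 \<sigma>2\<^sub>2 \<tau>2\<^sub>2 \<sigma>4\<^sub>2 \<tau>4\<^sub>2 where
        w'_eq: "w' = (((x\<^sub>2, e\<^sub>2, s1\<^sub>2, t1\<^sub>2), (y\<^sub>2, f3\<^sub>2, s3\<^sub>2, t3\<^sub>2)), ((s2\<^sub>2, t2\<^sub>2),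
          (((f1\<^sub>2, f2\<^sub>2, q\<^sub>2, k\<^sub>2), (f\<^sub>2, f4\<^sub>2, q'\<^sub>2, k'\<^sub>2)), (\<sigma>1\<^sub>2, \<tau>1\<^sub>2), (\<sigma>2\<^sub>2, \<tau>2\<^sub>2), (\<sigma>4\<^sub>2, \<tau>4\<^sub>2))))"
        by (metis surj_pair)
      note d = \<Omega>D[OF w[unfolded w_eq]]
      note d' = \<Omega>D[OF w'[unfolded w'_eq]]
      have o: "x + t1 = x\<^sub>2 + t1\<^sub>2" "x + s2 = x\<^sub>2 + s2\<^sub>2" "x + t2 = x\<^sub>2 + t2\<^sub>2"
        "y + \<sigma>1 = y\<^sub>2 + \<sigma>1\<^sub>2" "y + \<tau>1 = y\<^sub>2 + \<tau>1\<^sub>2" "y + \<sigma>2 = y\<^sub>2 + \<sigma>2\<^sub>2" "y + \<tau>2 = y\<^sub>2 + \<tau>2\<^sub>2"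
        "y + t3 = y\<^sub>2 + t3\<^sub>2" "y + \<sigma>4 = y\<^sub>2 + \<sigma>4\<^sub>2" "y + \<tau>4 = y\<^sub>2 + \<tau>4\<^sub>2" "y + q = y\<^sub>2 + q\<^sub>2" "y + q' = y\<^sub>2 + q'\<^sub>2"
        using out_eq by (auto simp: out_def w_eq w'_eq)
      \<comment> \<open>Equal outputs mean equal right-hand sides in \<open>block_identity\<close>,
        so the pivot form has the same value at both points and \<open>pivot_inj\<close> recovers
        \<open>x\<close> and \<open>y\<close>.\<close>
      have id: "(\<gamma> b1 - \<gamma> b2) * \<gamma> x + ((\<gamma> a1 - \<gamma> a2) - (\<gamma> b1 - \<gamma> b2)) * \<gamma> y \<simeq>
        D * (- \<gamma> (x + t1) - \<gamma> (x + s2) + \<gamma> (x + t2)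
          + \<gamma> (y + \<sigma>1) - \<gamma> (y + \<tau>1) - \<gamma> (y + \<sigma>2) + \<gamma> (y + \<tau>2)
          + \<gamma> (y + t3) + \<gamma> (y + \<sigma>4) - \<gamma> (y + \<tau>4) + \<gamma> (y + q) - \<gamma> (y + q'))"
        using d by (intro block_identity[of s1 t1 b1 e s2 t2 b2 \<sigma>1 \<tau>1 a1 f1 \<sigma>2 \<tau>2 a2 f2 s3 t3 f3 \<sigma>4 \<tau>4 f4 q k q' k' E x y]) blast+
      have id': "(\<gamma> b1 - \<gamma> b2) * \<gamma> x\<^sub>2 + ((\<gamma> a1 - \<gamma> a2) - (\<gamma> b1 - \<gamma> b2)) * \<gamma> y\<^sub>2 \<simeq>
        D * (- \<gamma> (x + t1) - \<gamma> (x + s2) + \<gamma> (x + t2)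
          + \<gamma> (y + \<sigma>1) - \<gamma> (y + \<tau>1) - \<gamma> (y + \<sigma>2) + \<gamma> (y + \<tau>2)
          + \<gamma> (y + t3) + \<gamma> (y + \<sigma>4) - \<gamma> (y + \<tau>4) + \<gamma> (y + q) - \<gamma> (y + q'))"
        unfolding o using d' by (intro block_identity[of s1\<^sub>2 t1\<^sub>2 b1 e\<^sub>2 s2\<^sub>2 t2\<^sub>2 b2 \<sigma>1\<^sub>2 \<tau>1\<^sub>2 a1 f1\<^sub>2 \<sigma>2\<^sub>2 \<tau>2\<^sub>2 a2 f2\<^sub>2 s3\<^sub>2 t3\<^sub>2 f3\<^sub>2 \<sigma>4\<^sub>2 \<tau>4\<^sub>2 f4\<^sub>2 q\<^sub>2 k\<^sub>2 q'\<^sub>2 k'\<^sub>2 E x\<^sub>2 y\<^sub>2]) blast+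
      have xy: "x = x\<^sub>2 \<and> y = y\<^sub>2"
      proof (rule pivot_inj[OF r u])
        show "\<not> p dvd \<gamma> b1 - \<gamma> b2" using ab\<Delta> b by (intro diff_nz) auto
        show "(\<gamma> b1 - \<gamma> b2) * \<gamma> x + (\<gamma> a1 - \<gamma> a2 - (\<gamma> b1 - \<gamma> b2)) * \<gamma> y \<simeq>
            (\<gamma> b1 - \<gamma> b2) * \<gamma> x\<^sub>2 + (\<gamma> a1 - \<gamma> a2 - (\<gamma> b1 - \<gamma> b2)) * \<gamma> y\<^sub>2"
          by (rule cong_trans[OF id cong_sym[OF id']])
      qed (use d d' in simp_all)
      with o have o': "t1 = t1\<^sub>2" "s2 = s2\<^sub>2" "t2 = t2\<^sub>2" "\<sigma>1 = \<sigma>1\<^sub>2" "\<tau>1 = \<tau>1\<^sub>2" "\<sigma>2 = \<sigma>2\<^sub>2" "\<tau>2 = \<tau>2\<^sub>2"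
        "t3 = t3\<^sub>2" "\<sigma>4 = \<sigma>4\<^sub>2" "\<tau>4 = \<tau>4\<^sub>2" "q = q\<^sub>2" "q' = q'\<^sub>2"
        by simp_all
      \<comment> \<open>The omitted data follow in order: \<open>e\<close> from the labels at
        \<open>b2\<close>, \<open>s1\<close> from \<open>t1\<close>, \<open>s3\<close> from the
        link, \<open>f3\<close> from \<open>s3\<close> and \<open>t3\<close>, the remaining
        exponents from their own labels, and finally \<open>k\<close>.\<close>
      have e: "e = e\<^sub>2"
        by (rule S_vertex_unique[of s2 t2 b2]) (use d d' o' in simp_all)
      have s1: "s1 = s1\<^sub>2"
        by (rule S_left_unique[of _ t1 b1 e]) (use d d' o' e in simp_all)
      have s3: "s3 = s3\<^sub>2" using d d' s1 xy by simp
      have f3: "f3 = f3\<^sub>2"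
        by (rule S_vertex_unique[of s3 t3 b1]) (use d d' o' s3 in simp_all)
      have f1: "f1 = f1\<^sub>2"
        by (rule S_vertex_unique[of \<sigma>1 \<tau>1 a1]) (use d d' o' in simp_all)
      have f2: "f2 = f2\<^sub>2"
        by (rule S_vertex_unique[of \<sigma>2 \<tau>2 a2]) (use d d' o' in simp_all)
      have f4: "f4 = f4\<^sub>2"
        by (rule S_vertex_unique[of \<sigma>4 \<tau>4 b2]) (use d d' o' in simp_all)
      have k: "k = k\<^sub>2"
        by (rule diff_reps_unique[of f1 f2 q _ E]) (use d d' o' f1 f2 in simp_all)
      show "w = w'"
        unfolding w_eq w'_eq using xy o' e s1 s3 f1 f2 f3 f4 k d d' by simp
    qed
    show "out ` \<Omega> \<subseteq> W \<times> W \<times> W \<times> W \<times> W \<times> W \<times> W \<times> W \<times> W \<times> W \<times> W \<times> W"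
    proof (rule image_subsetI)
      fix w assume w: "w \<in> \<Omega>"
      obtain x e s1 t1 y f3 s3 t3 s2 t2 f1 f2 q k f f4 q' k' \<sigma>1 \<tau>1 \<sigma>2 \<tau>2 \<sigma>4 \<tau>4 where
        w_eq: "w = (((x, e, s1, t1), (y, f3, s3, t3)), ((s2, t2),
          (((f1, f2, q, k), (f, f4, q', k')), (\<sigma>1, \<tau>1), (\<sigma>2, \<tau>2), (\<sigma>4, \<tau>4))))"
        by (metis surj_pair)
      note d = \<Omega>D[OF w[unfolded w_eq]]
      have "x \<in> {-N..N}" "y \<in> {-N..N}" using d B_subset \<Delta>_range by auto
      moreover have "t1 \<in> {-2*N..N}" "s2 \<in> {-2*N..N}" "t2 \<in> {-2*N..N}" "\<sigma>1 \<in> {-2*N..N}" "\<tau>1 \<in> {-2*N..N}"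
         "\<sigma>2 \<in> {-2*N..N}" "\<tau>2 \<in> {-2*N..N}" "t3 \<in> {-2*N..N}" "\<sigma>4 \<in> {-2*N..N}" "\<tau>4 \<in> {-2*N..N}"
         "q \<in> {-2*N..N}" "q' \<in> {-2*N..N}"
        using d ab\<Delta> S_range by blast+
      ultimately show "out w \<in> W \<times> W \<times> W \<times> W \<times> W \<times> W \<times> W \<times> W \<times> W \<times> W \<times> W \<times> W"
        by (simp add: w_eq out_def W_def)
    qed
    show "finite (W \<times> W \<times> W \<times> W \<times> W \<times> W \<times> W \<times> W \<times> W \<times> W \<times> W \<times> W)"
      by (simp add: W_def)
  qed
  have "card (W \<times> W \<times> W \<times> W \<times> W \<times> W \<times> W \<times> W \<times> W \<times> W \<times> W \<times> W) = card W ^ 12"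
    by (simp add: card_cartesian_product power_numeral_reduce)
  with upper have "real (card \<Omega>) \<le> real (card W ^ 12)" by (simp only: of_nat_le_iff)
  also have "\<dots> = real (card W) ^ 12" by (rule of_nat_power)
  also have "\<dots> \<le> (6 * n) ^ 12"
    by (rule power_mono) (use N_ge in \<open>auto simp: W_def n_def\<close>)
  finally have upper': "real (card \<Omega>) \<le> (6 * n) ^ 12" .

  \<comment> \<open>The lower bound for \<open>card \<Omega>\<close> multiplies the collisions, the
    choices in \<open>S b2 e\<close> and those in \<open>Rest f3\<close>; the upper bound is
    \<open>(6 * n) ^ 12\<close>. With \<open>\<theta>\<close> of order \<open>M ^ 2 / n\<close> and
    \<open>c\<close> of order \<open>M ^ 4 / n ^ 3\<close>, the comparison is between
    \<open>M ^ 23\<close> and \<open>n ^ 22\<close>.\<close>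
  define c where "c = M ^ 4 / (800 * n ^ 3)"
  have c: "0 \<le> c" using n_ge by (simp add: c_def)
  have "(M / 2 * (M / 4 * \<theta>))\<^sup>2 \<le> (real (card H))\<^sup>2"
    using cardH M_nonneg \<theta>_nonneg by (intro power_mono) auto
  then have 1: "(M / 2 * (M / 4 * \<theta>))\<^sup>2 \<le> 6 * n * real (card (collisions H key))"
    using cardC by linarith
  have "(M / 2) ^ 3 \<le> real (card E) ^ 3"
    using cardE M_nonneg by (intro power_mono) auto
  then have 2: "\<theta> ^ 4 * c * (M / 2) ^ 3 \<le> \<theta> ^ 4 * c * real (card E) ^ 3"
    using c by (intro mult_left_mono) auto
  have "(M / 2 * (M / 4 * \<theta>))\<^sup>2 * (\<theta> ^ 4 * c * (M / 2) ^ 3) \<le>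
      6 * n * real (card (collisions H key)) * (\<theta> ^ 4 * c * real (card E) ^ 3)"
    using c M_nonneg n_ge by (intro mult_mono[OF 1 2]) auto
  also have "\<dots> = 6 * n * (real (card (collisions H key)) *
     (\<theta> * (real (card E) ^ 3 * M ^ 4 / (800 * n ^ 3) * \<theta> ^ 3)))"
    by (simp add: c_def power_numeral_reduce)
  also have "\<dots> \<le> 6 * n * real (card \<Omega>)" using n_ge by (intro mult_left_mono[OF lower]) auto
  also have "\<dots> \<le> 6 * n * (6 * n) ^ 12" using n_ge by (intro mult_left_mono[OF upper']) auto
  also have "\<dots> = (6 * n) ^ 13" by (simp flip: power_Suc)
  finally have 3: "(M / 2 * (M / 4 * \<theta>))\<^sup>2 * (\<theta> ^ 4 * c * (M / 2) ^ 3) \<le> (6 * n) ^ 13" .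
  have M2: "\<theta> * (80 * n) = M ^ 2" using n_ge by (simp add: \<theta>_def)
  have "M ^ 23 = (M ^ 2) ^ 6 * M ^ 11" by (simp flip: power_mult power_add)
  also have "\<dots> = (\<theta> * (80 * n)) ^ 6 * M ^ 11" by (simp only: M2)
  \<comment> \<open>The denominators are collected by
    \<open>409600 = 8 ^ 2 * 2 ^ 3 * 800\<close>.\<close>
  also have "\<dots> = (M / 2 * (M / 4 * \<theta>))\<^sup>2 * (\<theta> ^ 4 * c * (M / 2) ^ 3) * (409600 * n ^ 3 * (80 * n) ^ 6)"
    using n_ge by (simp add: c_def power_mult_distrib power_divide power_numeral_reduce)
  also have "\<dots> \<le> (6 * n) ^ 13 * (409600 * n ^ 3 * (80 * n) ^ 6)"
    using 3 n_ge by (intro mult_right_mono) auto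
  also have "\<dots> = (6 ^ 13 * 409600 * 80 ^ 6) * (n ^ 13 * n ^ 3 * n ^ 6)"
    by (simp add: power_mult_distrib)
  also have "n ^ 13 * n ^ 3 * n ^ 6 = n ^ 22" by (simp flip: power_add)
  also have "(6 ^ 13 * 409600 * 80 ^ 6) * n ^ 22 \<le> 10 ^ 28 * n ^ 22"
    using n_ge by (intro mult_right_mono) auto
  finally show ?thesis .
qed

text \<open>If \<open>B\<close> has at most one element, then \<open>M \<le> 2\<close>. If all
  residues up to \<open>p - 2\<close> are ratios, the bound for \<open>M ^ 10\<close> is combined
  with \<open>M \<le> n\<close>. Otherwise \<open>ratios_exit\<close> provides a pivot.\<close>

theorem M_bound: "M ^ 23 \<le> 10 ^ 28 * n ^ 22"
proof (cases "\<exists>x\<in>B. \<exists>y\<in>B. x \<noteq> y")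
  case False
  then have "card B \<le> 1" using finite_B by (auto simp: card_le_Suc0_iff_eq)
  with card_B have "M \<le> 2" by linarith
  then have "M ^ 23 \<le> 2 ^ 23" using M_nonneg by (rule power_mono)
  also have "\<dots> \<le> 10 ^ 28 * (1 :: real)" by simp
  also have "\<dots> \<le> 10 ^ 28 * n ^ 22" using n_ge by (intro mult_left_mono one_le_power) auto
  finally show ?thesis .
next
  case True
  then have minus_one: "p - 1 \<in> ratios" using minus_one_in_ratios by blast
  show ?thesis
  proof (cases "{1..p - 2} \<subseteq> ratios")
    case True
    have "M ^ 23 = M ^ 10 * M ^ 13" by (simp flip: power_add)
    also have "\<dots> \<le> (2 * 10 ^ 14 * n ^ 9) * n ^ 13"
      using M_bound_if_ratios_full[OF True] M_le_n M_nonneg n_ge by (intro mult_mono power_mono) auto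
    also have "\<dots> = 2 * 10 ^ 14 * n ^ 22" by (simp flip: power_add)
    also have "\<dots> \<le> 10 ^ 28 * n ^ 22" using n_ge by (intro mult_right_mono) auto
    finally show ?thesis .
  next
    case False
    then obtain \<xi> where "\<xi> \<in> {1..p - 2}" "\<xi> \<notin> ratios" by blast
    from ratios_exit[OF this minus_one] obtain r
      where r: "r \<in> ratios" "r - 1 \<notin> ratios" "r - 1 \<in> {1..p - 2}" .
    from r(1) obtain x x' y y' where "x \<in> B" "x' \<in> B" "y \<in> B" "y' \<in> B" "y \<noteq> y'"
      "\<gamma> x - \<gamma> x' \<simeq> r * (\<gamma> y - \<gamma> y')"
      unfolding ratios_def by blast
    then show ?thesis using r by (intro M_bound_if_pivot)
  qed
qed

end

section \<open>Exponential sums\<close>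

lemma e_char_add: "e_char (s + t) = e_char s * e_char t"
  by (simp add: e_char_def algebra_simps exp_add)

lemma e_char_power: "e_char t ^ m = e_char (real m * t)"
  by (simp add: e_char_def algebra_simps flip: exp_of_nat_mult)

lemma cnj_e_char: "cnj (e_char t) = e_char (- t)"
  by (simp add: e_char_def exp_cnj)

lemma e_char_eq_1_iff: "e_char t = 1 \<longleftrightarrow> t \<in> \<int>"
proof -
  have "e_char t = 1 \<longleftrightarrow> (\<exists>m::int. 2 * pi * t = of_int (2 * m) * pi)"
    by (simp add: e_char_def exp_eq_1)
  also have "\<dots> \<longleftrightarrow> (\<exists>m::int. t = of_int m)" by (auto simp: mult.commute)
  finally show ?thesis by (auto simp: Ints_def)
qed

text \<open>Orthogonality: a geometric sum whose ratio is a \<open>p\<close>-th root of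
  unity.\<close>

lemma sum_e_char:
  assumes "p > 0"
  shows "(\<Sum>x = 0..<p. e_char (real x * of_int k / real p)) = (if int p dvd k then of_nat p else 0)"
proof -
  define w where "w = e_char (of_int k / real p)"
  have pow: "e_char (real x * of_int k / real p) = w ^ x" for x
    by (simp add: w_def e_char_power)
  have "w ^ p = e_char (of_int k)"
    using pow[of p] assms by simp
  then have wp: "w ^ p = 1" by (simp add: e_char_eq_1_iff)
  have "w = 1 \<longleftrightarrow> int p dvd k"
  proof -
    have "w = 1 \<longleftrightarrow> (\<exists>m::int. of_int k / real p = of_int m)"
      by (auto simp: w_def e_char_eq_1_iff Ints_def)
    also have "\<dots> \<longleftrightarrow> (\<exists>m::int. real_of_int k = real_of_int (int p * m))"
      using assms by (auto simp: field_simps)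
    also have "\<dots> \<longleftrightarrow> int p dvd k" unfolding of_int_eq_iff dvd_def by blast
    finally show ?thesis .
  qed
  moreover have "(\<Sum>x = 0..<p. w ^ x) = 0" if "w \<noteq> 1"
    using that wp by (simp add: atLeast0LessThan geometric_sum)
  ultimately show ?thesis by (auto simp: pow)
qed

lemma parseval_mod:
  fixes h :: "'a \<Rightarrow> int"
  assumes "p > 0" and A: "finite A"
  shows "(\<Sum>x = 0..<p. (cmod (\<Sum>a\<in>A. e_char (real x * of_int (h a) / real p)))\<^sup>2) =
    real p * real (card (collisions A (\<lambda>a. h a mod int p)))"
proof -
  have sq: "complex_of_real ((cmod (\<Sum>a\<in>A. e_char (real x * of_int (h a) / real p)))\<^sup>2) =
      (\<Sum>(a, b)\<in>A \<times> A. e_char (real x * of_int (h a - h b) / real p))" for x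
  proof -
    have "complex_of_real ((cmod (\<Sum>a\<in>A. e_char (real x * of_int (h a) / real p)))\<^sup>2) =
        (\<Sum>a\<in>A. e_char (real x * of_int (h a) / real p)) * (\<Sum>b\<in>A. e_char (- (real x * of_int (h b) / real p)))"
      by (simp only: complex_norm_square cnj_sum cnj_e_char)
    also have "\<dots> = (\<Sum>(a, b)\<in>A \<times> A. e_char (real x * of_int (h a - h b) / real p))"
      by (simp add: sum_product sum.cartesian_product e_char_add[symmetric] diff_divide_distrib
          right_diff_distrib)
    finally show ?thesis .
  qed
  have "complex_of_real (\<Sum>x = 0..<p. (cmod (\<Sum>a\<in>A. e_char (real x * of_int (h a) / real p)))\<^sup>2) =
      (\<Sum>x = 0..<p. \<Sum>z\<in>A \<times> A. e_char (real x * of_int (h (fst z) - h (snd z)) / real p))"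
    by (simp only: of_real_sum sq case_prod_unfold)
  also have "\<dots> = (\<Sum>z\<in>A \<times> A. \<Sum>x = 0..<p. e_char (real x * of_int (h (fst z) - h (snd z)) / real p))"
    by (rule sum.swap)
  also have "\<dots> = (\<Sum>z\<in>A \<times> A. if int p dvd h (fst z) - h (snd z) then of_nat p else 0)"
    by (simp only: sum_e_char[OF assms(1)])
  also have "\<dots> = (\<Sum>z\<in>{z \<in> A \<times> A. int p dvd h (fst z) - h (snd z)}. of_nat p)"
    using A by (intro sum.inter_filter[symmetric]) auto
  also have "{z \<in> A \<times> A. int p dvd h (fst z) - h (snd z)} = collisions A (\<lambda>a. h a mod int p)"
    by (auto simp: collisions_def mod_eq_dvd_iff)
  also have "(\<Sum>z\<in>collisions A (\<lambda>a. h a mod int p). of_nat p) =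
     complex_of_real (real p * real (card (collisions A (\<lambda>a. h a mod int p))))"
    by simp
  finally show ?thesis by (simp only: of_real_eq_iff)
qed

text \<open>Cauchy-Schwarz gives \<open>s2\<^sup>2 \<le> s1 * s3\<close> and
  \<open>s3\<^sup>2 \<le> s2 * s4\<close>; eliminating \<open>s3\<close> and dividing by
  \<open>s2\<close> bounds the second moment by the first and the fourth.\<close>

lemma sum_power_interpolation:
  fixes f :: "'a \<Rightarrow> real"
  assumes "\<And>x. x \<in> X \<Longrightarrow> 0 \<le> f x"
  shows "(\<Sum>x\<in>X. f x ^ 2) ^ 3 \<le> (\<Sum>x\<in>X. f x) ^ 2 * (\<Sum>x\<in>X. f x ^ 4)"
proof -
  define s1 where "s1 = (\<Sum>x\<in>X. f x)"
  define s2 where "s2 = (\<Sum>x\<in>X. f x ^ 2)"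
  define s3 where "s3 = (\<Sum>x\<in>X. f x ^ 3)"
  define s4 where "s4 = (\<Sum>x\<in>X. f x ^ 4)"
  have nonneg: "0 \<le> s1" "0 \<le> s2" "0 \<le> s3" "0 \<le> s4"
    unfolding s1_def s2_def s3_def s4_def using assms by (auto intro!: sum_nonneg)
  have "(\<Sum>x\<in>X. sqrt (f x) * (sqrt (f x) * f x))\<^sup>2 \<le>
      (\<Sum>x\<in>X. (sqrt (f x))\<^sup>2) * (\<Sum>x\<in>X. (sqrt (f x) * f x)\<^sup>2)"
    by (rule Cauchy_Schwarz_ineq_sum)
  also have "(\<Sum>x\<in>X. sqrt (f x) * (sqrt (f x) * f x)) = s2"
    unfolding s2_def using assms
    by (intro sum.cong) (auto simp: power2_eq_square simp flip: mult.assoc)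
  also have "(\<Sum>x\<in>X. (sqrt (f x))\<^sup>2) = s1" unfolding s1_def using assms by (intro sum.cong) auto
  also have "(\<Sum>x\<in>X. (sqrt (f x) * f x)\<^sup>2) = s3"
    unfolding s3_def using assms by (intro sum.cong) (auto simp: power_mult_distrib power_numeral_reduce)
  finally have 1: "s2\<^sup>2 \<le> s1 * s3" .
  have "(\<Sum>x\<in>X. f x * (f x)\<^sup>2)\<^sup>2 \<le> (\<Sum>x\<in>X. (f x)\<^sup>2) * (\<Sum>x\<in>X. ((f x)\<^sup>2)\<^sup>2)"
    by (rule Cauchy_Schwarz_ineq_sum)
  then have 2: "s3\<^sup>2 \<le> s2 * s4"
    by (simp add: s2_def s3_def s4_def power_numeral_reduce mult.assoc)
  have "(s2\<^sup>2)\<^sup>2 \<le> (s1 * s3)\<^sup>2" using 1 by (rule power_mono) simp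
  also have "\<dots> \<le> s1\<^sup>2 * (s2 * s4)"
    unfolding power_mult_distrib using 2 by (intro mult_left_mono) auto
  finally have "s2 * s2 ^ 3 \<le> s2 * (s1\<^sup>2 * s4)" by (simp add: power_numeral_reduce mult_ac)
  then have "s2 ^ 3 \<le> s1\<^sup>2 * s4"
    using nonneg by (cases "s2 = 0") (auto simp: mult_le_cancel_left)
  then show ?thesis by (simp only: s1_def s2_def s4_def)
qed

section \<open>Differences of powers of a primitive root\<close>

definition diff_sols :: "nat \<Rightarrow> nat \<Rightarrow> nat \<Rightarrow> int \<Rightarrow> (nat \<times> nat) set" where
  "diff_sols p g N d = {(i, k) \<in> {1..N} \<times> {1..N}. [int g ^ i - int g ^ k = d] (mod int p)}"

lemma finite_diff_sols: "finite (diff_sols p g N d)"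
  unfolding diff_sols_def by (rule finite_subset[of _ "{1..N} \<times> {1..N}"]) auto

lemma primroot_power_cong_iff:
  assumes "prime p" "residue_primroot p g"
  shows "[int g ^ i = int g ^ k] (mod int p) \<longleftrightarrow> [i = k] (mod (p - 1))"
proof -
  have "[int g ^ i = int g ^ k] (mod int p) \<longleftrightarrow> [g ^ i = g ^ k] (mod p)"
    by (simp only: cong_int_iff[symmetric] of_nat_power)
  also have "\<dots> \<longleftrightarrow> [i = k] (mod (p - 1))"
    using assms order_divides_expdiff[of p g i k] by (simp add: residue_primroot_def totient_prime)
  finally show ?thesis .
qed

text \<open>An instance of \<open>M_bound\<close>. Reducing exponents modulo \<open>p - 1\<close>
  extends the powers of \<open>g\<close> to negative exponents, and \<open>\<gamma>_inj\<close>
  holds because the period \<open>p - 1\<close> exceeds \<open>3 * N\<close>.\<close>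

lemma card_diff_sols_power_le:
  assumes p: "prime p" and g: "residue_primroot p g" and N: "5 \<le> N" and Np: "N\<^sup>2 < p"
    and d: "\<not> int p dvd d"
  shows "real (card (diff_sols p g N d)) ^ 23 \<le> 10 ^ 28 * real N ^ 22"
proof -
  define A where "A = diff_sols p g N d"
  define m where "m = p - 1"
  have "5 * N \<le> N\<^sup>2" using N by (simp add: power2_eq_square)
  then have m: "3 * N < m" "0 < m" using Np N by (auto simp: m_def)
  define \<gamma> where "\<gamma> z = int g ^ nat (z mod int m)" for z
  have \<gamma>_cong: "[\<gamma> a = \<gamma> b] (mod int p) \<longleftrightarrow> [a = b] (mod int m)" for a b
  proof -
    have "[\<gamma> a = \<gamma> b] (mod int p) \<longleftrightarrow> [nat (a mod int m) = nat (b mod int m)] (mod m)"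
      unfolding \<gamma>_def m_def by (rule primroot_power_cong_iff[OF p g])
    also have "\<dots> \<longleftrightarrow> [int (nat (a mod int m)) = int (nat (b mod int m))] (mod int m)"
      by (simp only: cong_int_iff)
    also have "\<dots> \<longleftrightarrow> [a = b] (mod int m)" using m by (simp add: cong_def)
    finally show ?thesis .
  qed
  have \<gamma>_nat: "[\<gamma> (int i) = int g ^ i] (mod int p)" for i
  proof -
    have "nat (int i mod int m) = i mod m" by (simp add: nat_mod_distrib)
    then show ?thesis
      unfolding \<gamma>_def by (simp only: primroot_power_cong_iff[OF p g, folded m_def] cong_mod_left cong_refl)
  qed
  have \<gamma>_add: "[\<gamma> (a + b) = \<gamma> a * \<gamma> b] (mod int p)" for a b
  proof -
    have "\<gamma> a * \<gamma> b = int g ^ (nat (a mod int m) + nat (b mod int m))"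
      by (simp add: \<gamma>_def power_add)
    also have "[\<dots> = \<gamma> (int (nat (a mod int m) + nat (b mod int m)))] (mod int p)"
      by (rule cong_sym[OF \<gamma>_nat])
    also have "[\<gamma> (int (nat (a mod int m) + nat (b mod int m))) = \<gamma> (a + b)] (mod int p)"
      unfolding \<gamma>_cong using m by (simp add: cong_def mod_simps)
    finally show ?thesis by (rule cong_sym)
  qed
  have pp: "prime (int p)" using p by simp
  have coprimeI: "coprime x (int p)" if "\<not> int p dvd x" for x
    using prime_imp_coprime[OF pp that] by (rule coprime_commute[THEN iffD1])
  have g_nz: "\<not> int p dvd int g ^ i" for i
  proof
    assume "int p dvd int g ^ i"
    then have "int p dvd int g" by (rule prime_dvd_power[OF pp])
    then have "p dvd g" by simp
    moreover have "coprime p g" using g by (simp add: residue_primroot_def)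
    ultimately have "is_unit p" by (intro coprime_common_divisor[of p g p]) simp_all
    then show False using p by auto
  qed
  have \<gamma>_nz: "\<not> int p dvd \<gamma> a" for a
    unfolding \<gamma>_def by (rule g_nz)
  have \<gamma>_inj: "a = b" if "[\<gamma> a = \<gamma> b] (mod int p)" "\<bar>a - b\<bar> \<le> 3 * int N" for a b
  proof -
    have "int m dvd a - b" using that(1)[unfolded \<gamma>_cong] by (simp only: cong_iff_dvd_diff)
    moreover have "\<bar>a - b\<bar> < int m" using that(2) m by linarith
    ultimately show ?thesis using dvd_imp_le_int[of "a - b" "int m"] by fastforce
  qed
  define dif where "dif = (\<lambda>(i, k). int i - int k :: int)"
  \<comment> \<open>Division of \<open>g ^ i - g ^ k \<equiv> d\<close> by \<open>g ^ k\<close>;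
    this is \<open>edge0\<close>, since \<open>\<delta> - \<phi> \<delta> = - k\<close> for
    \<open>\<delta> = i - k\<close>.\<close>
  have edge: "[\<gamma> (int i - int k) - 1 = d * \<gamma> (- int k)] (mod int p)" if "(i, k) \<in> A" for i k
  proof -
    have 1: "[\<gamma> (int i - int k) * \<gamma> (int k) = \<gamma> (int i)] (mod int p)"
      using cong_sym[OF \<gamma>_add[of "int i - int k" "int k"]] by simp
    have "\<gamma> 0 = 1" by (simp add: \<gamma>_def)
    then have 2: "[\<gamma> (- int k) * \<gamma> (int k) = 1] (mod int p)"
      using cong_sym[OF \<gamma>_add[of "- int k" "int k"]] by simp
    have "[int g ^ i - int g ^ k = d] (mod int p)" using that by (simp add: A_def diff_sols_def)
    then have 3: "[\<gamma> (int i) - \<gamma> (int k) = d] (mod int p)"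
      by (rule cong_trans[OF cong_diff[OF \<gamma>_nat[of i] \<gamma>_nat[of k]]])
    have "[\<gamma> (int i - int k) * \<gamma> (int k) - \<gamma> (int k) = d * 1] (mod int p)"
      using cong_trans[OF cong_diff[OF 1 cong_refl] 3] by simp
    then have "[\<gamma> (int i - int k) * \<gamma> (int k) - \<gamma> (int k) = d * (\<gamma> (- int k) * \<gamma> (int k))] (mod int p)"
      by (rule cong_trans[OF _ cong_mult[OF cong_refl cong_sym[OF 2]]])
    then have "[\<gamma> (int k) * (\<gamma> (int i - int k) - 1) = \<gamma> (int k) * (d * \<gamma> (- int k))] (mod int p)"
      by (simp add: algebra_simps)
    then show ?thesis by (rule cong_mult_lcancel[OF coprimeI[OF \<gamma>_nz], THEN iffD1])
  qed
  \<comment> \<open>By \<open>edge\<close>, the difference \<open>i - k\<close> determines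
    \<open>d * \<gamma> (- int k)\<close> modulo \<open>p\<close>, hence \<open>k\<close>, as
    \<open>d\<close> is invertible.\<close>
  have inj: "inj_on dif A"
  proof (rule inj_onI, clarify)
    fix i k i' k' assume ik: "(i, k) \<in> A" "(i', k') \<in> A" and eq: "dif (i, k) = dif (i', k')"
    have eq': "int i' - int k' = int i - int k" using eq by (simp add: dif_def)
    have "[d * \<gamma> (- int k) = d * \<gamma> (- int k')] (mod int p)"
      by (rule cong_trans[OF cong_sym[OF edge[OF ik(1)]] edge[OF ik(2), unfolded eq']])
    then have "[\<gamma> (- int k) = \<gamma> (- int k')] (mod int p)"
      by (rule cong_mult_lcancel[OF coprimeI[OF d], THEN iffD1])
    then have "- int k = - int k'"
      by (rule \<gamma>_inj) (use ik in \<open>auto simp: A_def diff_sols_def\<close>)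
    with eq show "i = i' \<and> k = k'" by (simp add: dif_def)
  qed
  define \<phi> where "\<phi> = (\<lambda>z. int (fst (inv_into A dif z)))"
  have \<phi>: "\<phi> (dif (i, k)) = int i" if "(i, k) \<in> A" for i k
    using inv_into_f_f[OF inj that] by (simp add: \<phi>_def)
  interpret zech_set "int p" "int N" d \<gamma> "dif ` A" \<phi>
  proof
    show "dif ` A \<subseteq> {- int N..int N}" by (auto simp: A_def diff_sols_def dif_def)
    show "\<phi> ` dif ` A \<subseteq> {1..int N}" using \<phi> by (auto simp: A_def diff_sols_def)
    \<comment> \<open>The first exponent \<open>i\<close> determines \<open>g ^ k\<close> as
      \<open>g ^ i - d\<close> modulo \<open>p\<close>, hence \<open>k\<close>.\<close>
    show "inj_on \<phi> (dif ` A)"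
    proof (rule inj_onI)
      fix z z' assume "z \<in> dif ` A" "z' \<in> dif ` A" and eq: "\<phi> z = \<phi> z'"
      then obtain i k i' k' where ik: "(i, k) \<in> A" "(i', k') \<in> A" and z: "z = dif (i, k)" "z' = dif (i', k')"
        by auto
      from eq have "i = i'" using \<phi>[OF ik(1)] \<phi>[OF ik(2)] z by simp
      have "[int g ^ i - int g ^ k = d] (mod int p)" "[int g ^ i - int g ^ k' = d] (mod int p)"
        using ik \<open>i = i'\<close> by (auto simp: A_def diff_sols_def)
      then have "[int g ^ i - int g ^ k = int g ^ i - int g ^ k'] (mod int p)"
        using cong_trans cong_sym by blast
      then have "[int g ^ i - (int g ^ i - int g ^ k) = int g ^ i - (int g ^ i - int g ^ k')] (mod int p)"
        by (rule cong_diff[OF cong_refl])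
      then have "[int g ^ k = int g ^ k'] (mod int p)" by simp
      then have "[\<gamma> (int k) = \<gamma> (int k')] (mod int p)"
        by (rule cong_trans[OF cong_trans[OF \<gamma>_nat[of k]] cong_sym[OF \<gamma>_nat[of k']]])
      then have "int k = int k'"
        by (rule \<gamma>_inj) (use ik in \<open>auto simp: A_def diff_sols_def\<close>)
      with z \<open>i = i'\<close> show "z = z'" by simp
    qed
    fix z assume "z \<in> dif ` A"
    then obtain i k where ik: "(i, k) \<in> A" "z = dif (i, k)" by auto
    then show "[\<gamma> z - 1 = d * \<gamma> (z - \<phi> z)] (mod int p)"
      using edge[OF ik(1)] \<phi>[OF ik(1)] by (simp add: dif_def)
  qed (use p N Np d \<gamma>_add \<gamma>_nz \<gamma>_inj in \<open>auto simp flip: of_nat_power\<close>)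
  have "M = real (card A)" unfolding M_def using card_image[OF inj] by simp
  moreover have "n = real N" by (simp add: n_def)
  ultimately show ?thesis using M_bound by (simp add: A_def)
qed

text \<open>Takes the 23rd root, using \<open>10 ^ 28 \<le> 17 ^ 23\<close>; for
  \<open>N < 5\<close> there are at most 16 pairs at all.\<close>

lemma card_diff_sols_le:
  assumes p: "prime p" and g: "residue_primroot p g" and Np: "N\<^sup>2 < p" and N0: "0 < N"
    and d: "\<not> int p dvd d"
  shows "real (card (diff_sols p g N d)) \<le> 17 * real N powr (22 / 23)"
proof (cases "5 \<le> N")
  case True
  let ?m = "real (card (diff_sols p g N d))"
  have "?m ^ 23 \<le> 10 ^ 28 * real N ^ 22" by (rule card_diff_sols_power_le[OF p g True Np d])
  also have "\<dots> \<le> 17 ^ 23 * real N ^ 22" by (rule mult_right_mono) auto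
  also have "\<dots> = (17 * real N powr (22 / 23)) ^ 23"
    using N0 by (simp add: power_mult_distrib powr_power powr_realpow)
  finally show ?thesis by (rule power_mono_iff[THEN iffD1, rotated 3]) auto
next
  case False
  have "card (diff_sols p g N d) \<le> card ({1..N} \<times> {1..N})"
    by (rule card_mono) (auto simp: diff_sols_def)
  also have "\<dots> = N * N" by simp
  also have "\<dots> \<le> 4 * 4" using False by (intro mult_mono) auto
  finally have "real (card (diff_sols p g N d)) \<le> 17 * 1" by simp
  also have "\<dots> \<le> 17 * real N powr (22 / 23)" using N0 by (intro mult_left_mono ge_one_powr_ge_zero) auto
  finally show ?thesis .
qed

section \<open>Additive energy and the first moment\<close>

lemma card_energy_le:
  assumes p: "prime p" and g: "residue_primroot p g" and Np: "N\<^sup>2 < p" and N0: "0 < N"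
  shows "real (card (collisions ({1..N} \<times> {1..N}) (\<lambda>(i, j). (int g ^ i + int g ^ j) mod int p)))
    \<le> 18 * (real N)\<^sup>2 * real N powr (22 / 23)"
proof -
  let ?X = "{1..N} \<times> {1..N}" and ?R = "17 * real N powr (22 / 23)"
  have N1: "N \<le> N\<^sup>2" by (simp add: power2_eq_square)
  have inj: "i = k" if "i \<in> {1..N}" "k \<in> {1..N}" "int p dvd int g ^ i - int g ^ k" for i k
  proof -
    have "[i = k] (mod (p - 1))"
      using that(3) primroot_power_cong_iff[OF p g] by (simp add: cong_iff_dvd_diff)
    then have "[int i = int k] (mod int (p - 1))" by (simp only: cong_int_iff)
    then have "int (p - 1) dvd int i - int k" by (simp only: cong_iff_dvd_diff)
    moreover have "\<bar>int i - int k\<bar> < int (p - 1)" using that N1 Np by auto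
    ultimately show ?thesis using dvd_imp_le_int[of "int i - int k" "int (p - 1)"] by fastforce
  qed
  define C where "C z = diff_sols p g N (int g ^ snd z - int g ^ fst z)" for z
  have "card (collisions ?X (\<lambda>(i, j). (int g ^ i + int g ^ j) mod int p)) \<le> card (Sigma ?X C)"
  \<comment> \<open>The relation is regrouped as
    \<open>g ^ i - g ^ k \<equiv> g ^ l - g ^ j\<close>, with \<open>j\<close> and \<open>l\<close>
    prescribed.\<close>
  proof (rule card_inj_on_le[of "\<lambda>((i, j), (k, l)). ((j, l), (i, k))"])
    show "(\<lambda>((i, j), (k, l)). ((j, l), (i, k))) ` collisions ?X (\<lambda>(i, j). (int g ^ i + int g ^ j) mod int p) \<subseteq> Sigma ?X C"
      by (auto simp: collisions_def C_def diff_sols_def cong_iff_dvd_diff mod_eq_dvd_iff algebra_simps)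
    show "finite (Sigma ?X C)" by (auto simp: C_def finite_diff_sols)
  qed (auto simp: inj_on_def)
  also have "card (Sigma ?X C) = (\<Sum>z\<in>?X. card (C z))"
    by (simp add: C_def finite_diff_sols)
  finally have "real (card (collisions ?X (\<lambda>(i, j). (int g ^ i + int g ^ j) mod int p))) \<le> (\<Sum>z\<in>?X. real (card (C z)))"
    by (simp only: of_nat_sum[symmetric] of_nat_le_iff)
  \<comment> \<open>For \<open>j = l\<close> the difference is zero and forces \<open>i = k\<close>.
    These cases contribute at most \<open>N\<^sup>2\<close> in total, which raises the constant from
    17 to 18.\<close>
  also have "\<dots> \<le> (\<Sum>z\<in>?X. (if fst z = snd z then real N else 0) + ?R)"
  proof (rule sum_mono)
    fix z assume z: "z \<in> ?X"
    show "real (card (C z)) \<le> (if fst z = snd z then real N else 0) + ?R"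
    proof (cases "fst z = snd z")
      case True
      have "C z \<subseteq> (\<lambda>i. (i, i)) ` {1..N}"
      proof clarify
        fix i k assume "(i, k) \<in> C z"
        with True have "i \<in> {1..N}" "k \<in> {1..N}" "int p dvd int g ^ i - int g ^ k"
          by (auto simp: C_def diff_sols_def cong_iff_dvd_diff)
        moreover from this have "i = k" by (rule inj)
        ultimately show "(i, k) \<in> (\<lambda>i. (i, i)) ` {1..N}" by blast
      qed
      then have "card (C z) \<le> card ((\<lambda>i. (i, i)) ` {1..N})" by (intro card_mono) auto
      also have "\<dots> \<le> N" using card_image_le[of "{1..N}" "\<lambda>i. (i, i)"] by simp
      finally have "real (card (C z)) \<le> real N" by simp
      moreover have "0 \<le> ?R" by simp
      ultimately show ?thesis unfolding if_P[OF True] by linarith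
    next
      case False
      then have "\<not> int p dvd int g ^ snd z - int g ^ fst z" using inj z by fastforce
      from card_diff_sols_le[OF p g Np N0 this] False show ?thesis by (simp add: C_def)
    qed
  qed
  also have "\<dots> = real N * real N + (real N * real N) * ?R"
  proof -
    have "(\<Sum>z\<in>?X. if fst z = snd z then real N else 0) = (\<Sum>i\<in>{1..N}. \<Sum>j\<in>{1..N}. if i = j then real N else 0)"
      by (simp only: sum.cartesian_product case_prod_unfold)
    also have "\<dots> = real N * real N" by simp
    finally show ?thesis by (simp only: sum.distrib) simp
  qed
  also have "\<dots> \<le> (real N * real N) * real N powr (22 / 23) + (real N * real N) * ?R"
  proof -
    have "1 \<le> real N powr (22 / 23)" using N0 by (intro ge_one_powr_ge_zero) auto
    then show ?thesis using mult_left_mono[of 1 "real N powr (22 / 23)" "real N * real N"] by simp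
  qed
  also have "\<dots> = 18 * (real N)\<^sup>2 * real N powr (22 / 23)" by (simp add: power2_eq_square)
  finally show ?thesis .
qed

theorem exponential_sum_L1_lower_bound:
  assumes p: "prime p" and g: "residue_primroot p g" and N0: "0 < N" and Np: "N\<^sup>2 < p"
  shows "real N powr (1 / 48) / 5 \<le>
    1 / real p * (\<Sum>x = 0..<p. cmod (\<Sum>n = 1..N. e_char (real x * real (g ^ n) / real p)))"
proof -
  define f where "f x = (\<Sum>n = 1..N. e_char (real x * of_int (int g ^ n) / real p))" for x
  have p0: "p > 0" using Np by simp
  have "real N \<le> real (card (collisions {1..N} (\<lambda>n. int g ^ n mod int p)))"
  proof -
    have "card ((\<lambda>i. (i, i)) ` {1..N}) \<le> card (collisions {1..N} (\<lambda>n. int g ^ n mod int p))"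
      by (intro card_mono finite_collisions) (auto simp: collisions_def)
    then show ?thesis by (simp add: card_image inj_on_def)
  qed
  then have s2: "real p * real N \<le> (\<Sum>x = 0..<p. cmod (f x) ^ 2)"
    unfolding f_def parseval_mod[OF p0 finite_atLeastAtMost] by (rule mult_left_mono) simp
  \<comment> \<open>The square of \<open>f x\<close> is the exponential sum over
    \<open>g ^ i + g ^ j\<close>, so \<open>parseval_mod\<close> turns the fourth moment into the
    additive energy.\<close>
  have "cmod (f x) ^ 4 = (cmod (\<Sum>z\<in>{1..N} \<times> {1..N}.
      e_char (real x * of_int (case z of (i, j) \<Rightarrow> int g ^ i + int g ^ j) / real p)))\<^sup>2" for x
  proof -
    have "f x * f x = (\<Sum>z\<in>{1..N} \<times> {1..N}.
        e_char (real x * of_int (case z of (i, j) \<Rightarrow> int g ^ i + int g ^ j) / real p))"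
      unfolding f_def
      by (simp add: sum_product sum.cartesian_product case_prod_unfold e_char_add[symmetric]
          add_divide_distrib distrib_left)
    moreover have "cmod (f x) ^ 4 = (cmod (f x * f x))\<^sup>2"
      by (simp add: norm_mult power_numeral_reduce)
    ultimately show ?thesis by (simp only:)
  qed
  then have "(\<Sum>x = 0..<p. cmod (f x) ^ 4) = real p *
      real (card (collisions ({1..N} \<times> {1..N}) (\<lambda>z. (case z of (i, j) \<Rightarrow> int g ^ i + int g ^ j) mod int p)))"
    by (simp only: parseval_mod[OF p0 finite_cartesian_product[OF finite_atLeastAtMost finite_atLeastAtMost]])
  also have "\<dots> \<le> real p * (18 * (real N)\<^sup>2 * real N powr (22 / 23))"
    using card_energy_le[OF p g Np N0] by (intro mult_left_mono) (auto simp: case_prod_unfold)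
  finally have s4: "(\<Sum>x = 0..<p. cmod (f x) ^ 4) \<le> real p * (18 * (real N)\<^sup>2 * real N powr (22 / 23))" .
  define X where "X = 1 / real p * (\<Sum>x = 0..<p. cmod (f x))"
  have X: "(\<Sum>x = 0..<p. cmod (f x)) = real p * X" using p0 by (simp add: X_def)
  have "(real p * real N) ^ 3 \<le> (\<Sum>x = 0..<p. cmod (f x) ^ 2) ^ 3"
    using s2 by (rule power_mono) simp
  also have "\<dots> \<le> (\<Sum>x = 0..<p. cmod (f x)) ^ 2 * (\<Sum>x = 0..<p. cmod (f x) ^ 4)"
    by (rule sum_power_interpolation) simp
  also have "\<dots> \<le> (real p * X)\<^sup>2 * (real p * (18 * (real N)\<^sup>2 * real N powr (22 / 23)))"
    unfolding X by (rule mult_left_mono[OF s4]) simp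
  finally have "(real p ^ 3 * (real N)\<^sup>2) * real N \<le> (real p ^ 3 * (real N)\<^sup>2) * (18 * X\<^sup>2 * real N powr (22 / 23))"
    by (simp add: power_mult_distrib power_numeral_reduce mult_ac)
  then have "real N \<le> 18 * X\<^sup>2 * real N powr (22 / 23)"
    using p0 N0 by (subst (asm) mult_le_cancel_left_pos) auto
  moreover have "real N = real N powr (1 / 23) * real N powr (22 / 23)"
    using N0 by (simp flip: powr_add)
  ultimately have "real N powr (1 / 23) * real N powr (22 / 23) \<le> 18 * X\<^sup>2 * real N powr (22 / 23)"
    by simp
  then have 1: "real N powr (1 / 23) \<le> 18 * X\<^sup>2"
    using N0 by (subst (asm) mult_le_cancel_right_pos) auto
  \<comment> \<open>The bound so far is of order \<open>N powr (1 / 46)\<close>; the weaker exponent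
    still follows, as \<open>1 / 24 \<le> 1 / 23\<close> and \<open>18 \<le> 25\<close>.\<close>
  have "(real N powr (1 / 48) / 5)\<^sup>2 = real N powr (1 / 24) / 25"
    using N0 by (simp add: power_divide powr_power)
  also have "\<dots> \<le> real N powr (1 / 23) / 18"
    using N0 by (intro frac_le powr_mono) auto
  also have "\<dots> \<le> X\<^sup>2" using 1 by simp
  finally have "real N powr (1 / 48) / 5 \<le> X"
    by (rule power2_le_imp_le) (simp add: X_def sum_nonneg)
  then show ?thesis by (simp add: X_def f_def)
qed

theorem theorem5:
  shows "\<exists>(c::real) (\<epsilon>::nat \<Rightarrow> real). c > 0 \<and> (\<epsilon> \<longlonglongrightarrow> 0) \<and>
    (\<forall>(p::nat) (g::nat) (N::nat). prime p \<longrightarrow> residue_primroot p g \<longrightarrow> N > 0 \<longrightarrow>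
       real N < sqrt (real p) \<longrightarrow>
       (1 / real p) * (\<Sum>x = 0..<p. cmod (\<Sum>n = 1..N. e_char (real x * real (g ^ n) / real p)))
         \<ge> c * real N powr (1/48 + \<epsilon> N))"
\<comment> \<open>The lower bound holds for every positive \<open>N\<close> with a fixed constant,
  so the error in the exponent is taken to be zero.\<close>
proof (intro exI[of _ "1 / 5 :: real"] exI[of _ "\<lambda>_. 0 :: real"] conjI allI impI)
  fix p g N :: nat
  assume p: "prime p" and g: "residue_primroot p g" and N: "N > 0" and Np: "real N < sqrt (real p)"
  from Np have "(real N)\<^sup>2 < real p"
    using real_less_rsqrt real_sqrt_less_iff by (metis abs_of_nat real_sqrt_abs)
  then have "N\<^sup>2 < p" by (simp flip: of_nat_power)
  from exponential_sum_L1_lower_bound[OF p g N this]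
  show "(1 / real p) * (\<Sum>x = 0..<p. cmod (\<Sum>n = 1..N. e_char (real x * real (g ^ n) / real p)))
         \<ge> 1 / 5 * real N powr (1/48 + 0)"
    by simp
qed auto

end
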